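(* Let $E$ be a (possibly non-finite) directed graph and let $R$ be an associative unital ring. Then the Leavitt path algebra $L_R(E)$, equipped with its canonical $\mathbb{Z}$-gradation, is nearly epsilon-strongly $\mathbb{Z}$-graded.
   Context: All rings are associative but not necessarily unital. Graphs. A directed graph $E=(E^0,E^1,r,s)$ consists of sets $E^0$ (vertices), $E^1$ (edges) and maps $r,s:E^1\to E^0$ (range, source). Leavitt path algebra. $L_R(E)$ is the (not necessarily unital) algebra with coefficients in $R$ generated by the sets $\{v\mid v\in E^0\}$, $\{f\mid f\in E^1\}$, $\{f^*\mid f\in E^1\}$, subject to: (1) $uv=\delta_{u,v}v$ for all $u,v\in E^0$; (2) $s(f)f=fr(f)=f$ and $r(f)f^*=f^*s(f)=f^*$ for all $f\in E^1$; (3) $f^*f'=\delta_{f,f'}r(f)$ for all $f,f'\in E^1$; (4) $\sum_{f\in E^1,\,s(f)=v}ff^*=v$ for every $v\in E^0$ for which $s^{-1}(v)$ is non-empty and finite. The elements of $R$ commute with the generators. Canonical $\mathbb{Z}$-gradation. It is the $\mathbb{Z}$-gradation on $L_R(E)$ determined by $\deg(v)=0$ for $v\in E^0$, $\deg(f)=1$ and $\deg(f^* )=-1$ for $f\in E^1$ (elements of $R$ have degree $0$). Graded rings. For a group $G$, a ring $S$ is $G$-graded if $S=\bigoplus_{g\in G}S_g$ with $S_g$ additive subgroups and $S_gS_h\subseteq S_{gh}$ for all $g,h\in G$; products of additive subgroups denote the set of finite sums of products. s-unital bimodules. For rings $T,T'$, a $T$–$T'$-bimodule $M$ is s-unital if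 for each $m\in M$ there are $t\in T$ and $t'\in T'$ with $tm=m=mt'$. Nearly epsilon-strongly graded. A $G$-graded ring $S$ is nearly epsilon-strongly $G$-graded if for each $g\in G$ the $S_gS_{g^{-1}}$–$S_{g^{-1}}S_g$-bimodule $S_g$ is s-unital. *)

theory Defs
  imports
    "HOL-Algebra.QuotRing"
    "HOL-Algebra.Elementary_Groups"
    "Graph_Theory.Digraph"
begin

section \<open>Rings without unit and s-unital bimodules\<close>

text \<open>
  Non-unital rings are represented by the ring record of HOL-Algebra with the \<open>one\<close> field ignored;
  that field need not even lie in the carrier.
\<close>

locale rng = abelian_group S for S (structure) +
  assumes rng_m_closed: "\<lbrakk>x \<in> carrier S; y \<in> carrier S\<rbrakk> \<Longrightarrow> x \<otimes> y \<in> carrier S"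
    and rng_m_assoc: "\<lbrakk>x \<in> carrier S; y \<in> carrier S; z \<in> carrier S\<rbrakk> \<Longrightarrow>
      (x \<otimes> y) \<otimes> z = x \<otimes> (y \<otimes> z)"
    and rng_l_distr: "\<lbrakk>x \<in> carrier S; y \<in> carrier S; z \<in> carrier S\<rbrakk> \<Longrightarrow>
      (x \<oplus> y) \<otimes> z = x \<otimes> z \<oplus> y \<otimes> z"
    and rng_r_distr: "\<lbrakk>x \<in> carrier S; y \<in> carrier S; z \<in> carrier S\<rbrakk> \<Longrightarrow>
      z \<otimes> (x \<oplus> y) = z \<otimes> x \<oplus> z \<otimes> y"

text \<open>
  A \<open>T\<close>-\<open>T'\<close>-bimodule \<open>M\<close> with left action \<open>la\<close> and right action \<open>ra\<close>. Of the record \<open>M\<close> only the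
  additive structure is used.
\<close>

locale rng_bimodule = T: rng T + T': rng T' + M: abelian_group M
  for T (structure) and T' (structure) and M (structure) +
  fixes la and ra
  assumes la_closed: "\<lbrakk>t \<in> carrier T; m \<in> carrier M\<rbrakk> \<Longrightarrow> la t m \<in> carrier M"
    and ra_closed: "\<lbrakk>m \<in> carrier M; t' \<in> carrier T'\<rbrakk> \<Longrightarrow> ra m t' \<in> carrier M"
    and la_add_left: "\<lbrakk>t \<in> carrier T; u \<in> carrier T; m \<in> carrier M\<rbrakk> \<Longrightarrow>
      la (t \<oplus>\<^bsub>T\<^esub> u) m = la t m \<oplus>\<^bsub>M\<^esub> la u m"
    and la_add_right: "\<lbrakk>t \<in> carrier T; m \<in> carrier M; n \<in> carrier M\<rbrakk> \<Longrightarrow>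
      la t (m \<oplus>\<^bsub>M\<^esub> n) = la t m \<oplus>\<^bsub>M\<^esub> la t n"
    and la_mult: "\<lbrakk>t \<in> carrier T; u \<in> carrier T; m \<in> carrier M\<rbrakk> \<Longrightarrow>
      la (t \<otimes>\<^bsub>T\<^esub> u) m = la t (la u m)"
    and ra_add_left: "\<lbrakk>m \<in> carrier M; n \<in> carrier M; t' \<in> carrier T'\<rbrakk> \<Longrightarrow>
      ra (m \<oplus>\<^bsub>M\<^esub> n) t' = ra m t' \<oplus>\<^bsub>M\<^esub> ra n t'"
    and ra_add_right: "\<lbrakk>m \<in> carrier M; t' \<in> carrier T'; u' \<in> carrier T'\<rbrakk> \<Longrightarrow>
      ra m (t' \<oplus>\<^bsub>T'\<^esub> u') = ra m t' \<oplus>\<^bsub>M\<^esub> ra m u'"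
    and ra_mult: "\<lbrakk>m \<in> carrier M; t' \<in> carrier T'; u' \<in> carrier T'\<rbrakk> \<Longrightarrow>
      ra m (t' \<otimes>\<^bsub>T'\<^esub> u') = ra (ra m t') u'"
    and la_ra: "\<lbrakk>t \<in> carrier T; m \<in> carrier M; t' \<in> carrier T'\<rbrakk> \<Longrightarrow>
      ra (la t m) t' = la t (ra m t')"

locale s_unital_bimodule = rng_bimodule +
  assumes s_unital: "m \<in> carrier M \<Longrightarrow>
    \<exists>t \<in> carrier T. \<exists>t' \<in> carrier T'. la t m = m \<and> m = ra m t'"


section \<open>Graded rings\<close>

text \<open>The set of all finite sums of products \<open>a \<otimes> b\<close> with \<open>a \<in> A\<close> and \<open>b \<in> B\<close>.\<close>

definition prod_sums :: "('a, 'm) ring_scheme \<Rightarrow> 'a set \<Rightarrow> 'a set \<Rightarrow> 'a set" where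
  "prod_sums S A B =
    {(\<Oplus>\<^bsub>S\<^esub>i\<in>{..<n}. a i \<otimes>\<^bsub>S\<^esub> b i) | (n::nat) a b. (\<forall>i<n. a i \<in> A \<and> b i \<in> B)}"

locale graded_rng = G: group G + S: rng S
  for G (structure) and S (structure) and C +
  assumes component_subgroup: "g \<in> carrier G \<Longrightarrow> additive_subgroup (C g) S"
    and direct_sum: "x \<in> carrier S \<Longrightarrow>
      \<exists>!c. c \<in> (\<Pi>\<^sub>E g\<in>carrier G. C g) \<and> finite {g \<in> carrier G. c g \<noteq> \<zero>\<^bsub>S\<^esub>} \<and>
        x = (\<Oplus>\<^bsub>S\<^esub>g\<in>{g \<in> carrier G. c g \<noteq> \<zero>\<^bsub>S\<^esub>}. c g)"
    and component_mult: "\<lbrakk>g \<in> carrier G; h \<in> carrier G\<rbrakk> \<Longrightarrow>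
      prod_sums S (C g) (C h) \<subseteq> C (g \<otimes>\<^bsub>G\<^esub> h)"

locale nearly_epsilon_strongly_graded = graded_rng +
  assumes s_unital_component: "g \<in> carrier G \<Longrightarrow>
    s_unital_bimodule
      (S\<lparr>carrier := prod_sums S (C g) (C (inv\<^bsub>G\<^esub> g))\<rparr>)
      (S\<lparr>carrier := prod_sums S (C (inv\<^bsub>G\<^esub> g)) (C g)\<rparr>)
      (S\<lparr>carrier := C g\<rparr>)
      (\<lambda>t m. t \<otimes>\<^bsub>S\<^esub> m) (\<lambda>m t'. m \<otimes>\<^bsub>S\<^esub> t')"


section \<open>Free algebras\<close>

text \<open>
  The free unital \<open>R\<close>-algebra on \<open>X\<close>: finitely supported \<open>R\<close>-valued functions on words over \<open>X\<close>, with
  the convolution product. The ring \<open>R\<close> need not be commutative, but its elements commute with the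
  words.
\<close>

definition free_algebra :: "('r, 'm) ring_scheme \<Rightarrow> 'x set \<Rightarrow> ('x list \<Rightarrow> 'r) ring" where
  "free_algebra R X =
    \<lparr>carrier = {p. (\<forall>w. p w \<in> carrier R) \<and> finite {w. p w \<noteq> \<zero>\<^bsub>R\<^esub>} \<and>
                   {w. p w \<noteq> \<zero>\<^bsub>R\<^esub>} \<subseteq> lists X},
     mult = (\<lambda>p q w. \<Oplus>\<^bsub>R\<^esub>i\<in>{..length w}. p (take i w) \<otimes>\<^bsub>R\<^esub> q (drop i w)),
     one = (\<lambda>w. if w = [] then \<one>\<^bsub>R\<^esub> else \<zero>\<^bsub>R\<^esub>),
     zero = (\<lambda>w. \<zero>\<^bsub>R\<^esub>),
     add = (\<lambda>p q w. p w \<oplus>\<^bsub>R\<^esub> q w)\<rparr>"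

text \<open>The free non-unital \<open>R\<close>-algebra on \<open>X\<close>, as a subset of the unital one.\<close>

definition free_nonunital :: "('r, 'm) ring_scheme \<Rightarrow> 'x set \<Rightarrow> ('x list \<Rightarrow> 'r) set" where
  "free_nonunital R X = {p \<in> carrier (free_algebra R X). p [] = \<zero>\<^bsub>R\<^esub>}"

definition monomial :: "('r, 'm) ring_scheme \<Rightarrow> 'x list \<Rightarrow> 'x list \<Rightarrow> 'r" where
  "monomial R u = (\<lambda>w. if w = u then \<one>\<^bsub>R\<^esub> else \<zero>\<^bsub>R\<^esub>)"


section \<open>Leavitt path algebras\<close>

text \<open>In terms of the record of directed graphs, the source map is \<open>tail\<close>, the range map is \<open>head\<close>.\<close>

datatype ('v, 'e) lpa_gen = Vert 'v | Edge 'e | Ghost 'e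

definition lpa_gens :: "('v, 'e) pre_digraph \<Rightarrow> ('v, 'e) lpa_gen set" where
  "lpa_gens E = Vert ` verts E \<union> Edge ` arcs E \<union> Ghost ` arcs E"

abbreviation lpa_free ::
    "('r, 'm) ring_scheme \<Rightarrow> ('v, 'e) pre_digraph \<Rightarrow> (('v, 'e) lpa_gen list \<Rightarrow> 'r) ring" where
  "lpa_free R E \<equiv> free_algebra R (lpa_gens E)"

text \<open>A pair \<open>(a, b)\<close> stands for the relation \<open>a = b\<close>.\<close>

inductive_set lpa_relations ::
    "('r, 'm) ring_scheme \<Rightarrow> ('v, 'e) pre_digraph \<Rightarrow>
      ((('v, 'e) lpa_gen list \<Rightarrow> 'r) \<times> (('v, 'e) lpa_gen list \<Rightarrow> 'r)) set"
  for R :: "('r, 'm) ring_scheme" and E :: "('v, 'e) pre_digraph" where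
  vert_idem: "v \<in> verts E \<Longrightarrow>
    (monomial R [Vert v, Vert v], monomial R [Vert v]) \<in> lpa_relations R E"
| vert_orth: "\<lbrakk>u \<in> verts E; v \<in> verts E; u \<noteq> v\<rbrakk> \<Longrightarrow>
    (monomial R [Vert u, Vert v], \<zero>\<^bsub>lpa_free R E\<^esub>) \<in> lpa_relations R E"
| source_edge: "f \<in> arcs E \<Longrightarrow>
    (monomial R [Vert (tail E f), Edge f], monomial R [Edge f]) \<in> lpa_relations R E"
| edge_range: "f \<in> arcs E \<Longrightarrow>
    (monomial R [Edge f, Vert (head E f)], monomial R [Edge f]) \<in> lpa_relations R E"
| range_ghost: "f \<in> arcs E \<Longrightarrow>
    (monomial R [Vert (head E f), Ghost f], monomial R [Ghost f]) \<in> lpa_relations R E"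
| ghost_source: "f \<in> arcs E \<Longrightarrow>
    (monomial R [Ghost f, Vert (tail E f)], monomial R [Ghost f]) \<in> lpa_relations R E"
| ghost_edge_same: "f \<in> arcs E \<Longrightarrow>
    (monomial R [Ghost f, Edge f], monomial R [Vert (head E f)]) \<in> lpa_relations R E"
| ghost_edge_diff: "\<lbrakk>f \<in> arcs E; f' \<in> arcs E; f \<noteq> f'\<rbrakk> \<Longrightarrow>
    (monomial R [Ghost f, Edge f'], \<zero>\<^bsub>lpa_free R E\<^esub>) \<in> lpa_relations R E"
| edge_ghost_sum: "\<lbrakk>v \<in> verts E; out_arcs E v \<noteq> {}; finite (out_arcs E v)\<rbrakk> \<Longrightarrow>
    ((\<Oplus>\<^bsub>lpa_free R E\<^esub>f\<in>out_arcs E v. monomial R [Edge f, Ghost f]), monomial R [Vert v])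
      \<in> lpa_relations R E"

definition lpa_ideal ::
    "('r, 'm) ring_scheme \<Rightarrow> ('v, 'e) pre_digraph \<Rightarrow> (('v, 'e) lpa_gen list \<Rightarrow> 'r) set" where
  "lpa_ideal R E =
    Idl\<^bsub>lpa_free R E\<^esub> {a \<ominus>\<^bsub>lpa_free R E\<^esub> b | a b. (a, b) \<in> lpa_relations R E}"

text \<open>
  All relations lie in the free non-unital algebra, so the ideal they generate in the free unital
  algebra \<open>F\<close> is the ideal of the free non-unital algebra generated by them (closed under
  multiplication by scalars from \<open>R\<close>). Hence the image of the free non-unital algebra in the quotient
  of \<open>F\<close> is the non-unital algebra presented by the relations. As above, the \<open>one\<close> field of the
  resulting record (the coset of the empty word) carries no meaning.
\<close>

definition leavitt_path_algebra ::
    "('r, 'm) ring_scheme \<Rightarrow> ('v, 'e) pre_digraph \<Rightarrow> (('v, 'e) lpa_gen list \<Rightarrow> 'r) set ring" where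
  "leavitt_path_algebra R E =
    (lpa_free R E Quot lpa_ideal R E)
      \<lparr>carrier := {lpa_ideal R E +>\<^bsub>lpa_free R E\<^esub> p | p. p \<in> free_nonunital R (lpa_gens E)}\<rparr>"

fun gen_degree :: "('v, 'e) lpa_gen \<Rightarrow> int" where
  "gen_degree (Vert v) = 0"
| "gen_degree (Edge f) = 1"
| "gen_degree (Ghost f) = - 1"

definition word_degree :: "('v, 'e) lpa_gen list \<Rightarrow> int" where
  "word_degree w = (\<Sum>x\<leftarrow>w. gen_degree x)"

definition leavitt_grading ::
    "('r, 'm) ring_scheme \<Rightarrow> ('v, 'e) pre_digraph \<Rightarrow> int \<Rightarrow> (('v, 'e) lpa_gen list \<Rightarrow> 'r) set set" where
  "leavitt_grading R E n =
    {lpa_ideal R E +>\<^bsub>lpa_free R E\<^esub> p | p. p \<in> free_nonunital R (lpa_gens E) \<and>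
      (\<forall>w. p w \<noteq> \<zero>\<^bsub>R\<^esub> \<longrightarrow> word_degree w = n)}"

end

theory Submission
  imports Defs
begin

text \<open>
  Every word \<open>w\<close> in the generators of a Leavitt path algebra has an adjoint \<open>w\<^sup>*\<close>, obtained by reversing
  \<open>w\<close> and exchanging edges with ghost edges. The words behave like the elements of an inverse
  semigroup: \<open>w w\<^sup>* w = w\<close>, and the idempotents \<open>w w\<^sup>*\<close> commute with each other
  (\<open>word_adjoint_word\<close>, \<open>range_proj_commute\<close>). Let \<open>S\<^sub>n\<close> be the component
  of degree \<open>n\<close>. If \<open>w\<close> has degree \<open>n\<close>, then \<open>w w\<^sup>*\<close> lies in
  \<open>S\<^sub>n S\<^sub>-\<^sub>n\<close> and is a left unit for \<open>w\<close>; likewise \<open>w\<^sup>* w\<close> lies in \<open>S\<^sub>-\<^sub>n S\<^sub>n\<close> and is a right unit for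
  \<open>w\<close>. An element of \<open>S\<^sub>n\<close> is a finite combination of words of degree \<open>n\<close> with coefficients that
  commute with the words, so a common unit for these words suffices. It exists because for commuting
  idempotents \<open>t\<close> and \<open>e\<close> the element \<open>e + t - t e\<close> is an idempotent absorbing both, and the ring
  \<open>S\<^sub>n S\<^sub>-\<^sub>n\<close> contains it along with \<open>t\<close> and \<open>e\<close> (\<open>range_proj_common_unit\<close>). This treats
  positive and negative degrees alike.

  It remains to see that the Leavitt path algebra is graded at all. The free algebra is graded by the
  degree of words, and the defining relations are homogeneous, so the ideal that they generate
  contains the homogeneous parts of its elements (\<open>degree_part_in_homogeneous_ideal\<close>). Hence taking
  homogeneous parts is well defined on cosets, and these projections determine the decomposition of
  an element into components (\<open>graded_rng_by_projections\<close>).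
\<close>

section \<open>Sums of products and graded rings\<close>

context rng
begin

lemma rng_l_null [simp]: "x \<in> carrier S \<Longrightarrow> \<zero> \<otimes> x = \<zero>"
  by (metis add.l_cancel_one' local.rng_axioms rng.rng_l_distr rng.rng_m_closed zero_closed l_zero)

lemma rng_l_minus:
  assumes "x \<in> carrier S" "y \<in> carrier S"
  shows "(\<ominus> x) \<otimes> y = \<ominus> (x \<otimes> y)"
proof -
  have "(\<ominus> x) \<otimes> y \<oplus> x \<otimes> y = \<zero>"
    using assms by (simp add: rng_l_distr[symmetric] l_neg)
  then show ?thesis
    using assms by (simp add: add.inv_equality rng_m_closed)
qed

lemma additive_subgroup_intro:
  assumes "H \<subseteq> carrier S" "\<zero> \<in> H" "\<And>x y. x \<in> H \<Longrightarrow> y \<in> H \<Longrightarrow> x \<oplus> y \<in> H"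
    "\<And>x. x \<in> H \<Longrightarrow> \<ominus> x \<in> H"
  shows "additive_subgroup H S"
  by (intro additive_subgroupI add.subgroupI) (use assms in \<open>auto\<close>)

lemma abelian_group_restrict:
  assumes "additive_subgroup H S"
  shows "abelian_group (S\<lparr>carrier := H\<rparr>)"
proof -
  interpret H: additive_subgroup H S by fact
  show ?thesis
    by (rule abelian_groupI)
      (use H.a_subset H.a_inv_closed in \<open>auto simp: a_assoc subset_iff intro!: a_comm bexI[of _ "\<ominus> _"] l_neg\<close>)
qed

lemma rng_restrict:
  assumes H: "additive_subgroup H S" and mult: "\<And>x y. x \<in> H \<Longrightarrow> y \<in> H \<Longrightarrow> x \<otimes> y \<in> H"
  shows "rng (S\<lparr>carrier := H\<rparr>)"
proof -
  interpret H: additive_subgroup H S by fact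
  show ?thesis
    using H.a_subset mult
    by (intro rng.intro abelian_group_restrict H rng_axioms.intro)
      (auto simp: subset_iff rng_m_assoc rng_l_distr rng_r_distr)
qed

lemma prod_sums_zero: "\<zero> \<in> prod_sums S A B"
  unfolding prod_sums_def by (auto intro!: exI[of _ "0::nat"])

text \<open>
  This and \<open>prod_sums_zero\<close> generate all sums of products, as \<open>prod_sums_induct\<close> states.
\<close>

lemma prod_sums_add_mult:
  assumes AB: "A \<subseteq> carrier S" "B \<subseteq> carrier S"
    and x: "x \<in> prod_sums S A B" and "a \<in> A" "b \<in> B"
  shows "x \<oplus> a \<otimes> b \<in> prod_sums S A B"
proof -
  obtain n :: nat and f g where x_eq: "x = (\<Oplus>i\<in>{..<n}. f i \<otimes> g i)"
    and fg: "\<forall>i<n. f i \<in> A \<and> g i \<in> B"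
    using x unfolding prod_sums_def by blast
  define f' where "f' = f(n := a)"
  define g' where "g' = g(n := b)"
  have fg': "\<forall>i<Suc n. f' i \<in> A \<and> g' i \<in> B"
    using fg assms by (auto simp: f'_def g'_def less_Suc_eq)
  have in_S: "f' i \<otimes> g' i \<in> carrier S" if "i < Suc n" for i
    using fg' that AB by (intro rng_m_closed) auto
  have "(\<Oplus>i\<in>{..<Suc n}. f' i \<otimes> g' i) = f' n \<otimes> g' n \<oplus> (\<Oplus>i\<in>{..<n}. f' i \<otimes> g' i)"
    unfolding lessThan_Suc using in_S by (subst finsum_insert) auto
  also have "(\<Oplus>i\<in>{..<n}. f' i \<otimes> g' i) = x"
    unfolding x_eq
  proof (intro finsum_cong')
    show "(\<lambda>i. f i \<otimes> g i) \<in> {..<n} \<rightarrow> carrier S"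
      using fg AB by (auto intro!: rng_m_closed)
  qed (auto simp: f'_def g'_def)
  also have "f' n \<otimes> g' n \<oplus> x = x \<oplus> a \<otimes> b"
  proof -
    have "x \<in> carrier S"
      unfolding x_eq using fg AB by (intro finsum_closed) (auto intro!: rng_m_closed)
    with assms show ?thesis by (auto simp: f'_def g'_def intro!: a_comm rng_m_closed)
  qed
  finally show ?thesis
    unfolding prod_sums_def using fg'
    by (intro CollectI exI[of _ "Suc n"] exI[of _ f'] exI[of _ g'] conjI) auto
qed

lemma prod_sums_induct [consumes 3, case_names zero add_mult]:
  assumes AB: "A \<subseteq> carrier S" "B \<subseteq> carrier S"
    and "x \<in> prod_sums S A B"
    and zero: "P \<zero>"
    and add_mult: "\<And>x a b. \<lbrakk>x \<in> carrier S; x \<in> prod_sums S A B; P x; a \<in> A; b \<in> B\<rbrakk> \<Longrightarrow> P (x \<oplus> a \<otimes> b)"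
  shows "P x"
proof -
  obtain n :: nat and f g where x_eq: "x = (\<Oplus>i\<in>{..<n}. f i \<otimes> g i)"
    and fg: "\<forall>i<n. f i \<in> A \<and> g i \<in> B"
    using assms unfolding prod_sums_def by blast
  have in_S: "f i \<otimes> g i \<in> carrier S" if "i < n" for i
    using fg that AB by (intro rng_m_closed) auto
  have "P (\<Oplus>i\<in>{..<k}. f i \<otimes> g i)" if "k \<le> n" for k
    using that
  proof (induction k)
    case 0
    then show ?case by (simp add: zero)
  next
    case (Suc k)
    let ?y = "\<Oplus>i\<in>{..<k}. f i \<otimes> g i"
    have y: "?y \<in> carrier S" using in_S Suc.prems by (intro finsum_closed) auto
    have ps: "?y \<in> prod_sums S A B"
      unfolding prod_sums_def using fg Suc.prems by fastforce
    have "(\<Oplus>i\<in>{..<Suc k}. f i \<otimes> g i) = f k \<otimes> g k \<oplus> ?y"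
      unfolding lessThan_Suc using in_S Suc.prems by (subst finsum_insert) auto
    also have "\<dots> = ?y \<oplus> f k \<otimes> g k"
      using y in_S Suc.prems by (intro a_comm) auto
    finally show ?case
      using add_mult[OF y ps] Suc fg by simp
  qed
  then show ?thesis by (simp add: x_eq)
qed

lemma prod_sums_subset:
  assumes H: "additive_subgroup H S" and "A \<subseteq> carrier S" "B \<subseteq> carrier S"
    and AB: "\<And>a b. a \<in> A \<Longrightarrow> b \<in> B \<Longrightarrow> a \<otimes> b \<in> H"
  shows "prod_sums S A B \<subseteq> H"
proof
  interpret H: additive_subgroup H S by fact
  show "x \<in> H" if "x \<in> prod_sums S A B" for x
    using assms(2,3) that by (induction rule: prod_sums_induct) (auto intro: AB)
qed

lemma mult_in_prod_sums:
  assumes "A \<subseteq> carrier S" "B \<subseteq> carrier S" "a \<in> A" "b \<in> B"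
  shows "a \<otimes> b \<in> prod_sums S A B"
  using prod_sums_add_mult[OF assms(1,2) prod_sums_zero assms(3,4)] assms
  by (simp add: rng_m_closed subset_iff)

lemma prod_sums_additive_subgroup:
  assumes A: "additive_subgroup A S" and B: "additive_subgroup B S"
  shows "additive_subgroup (prod_sums S A B) S"
proof -
  interpret A: additive_subgroup A S by fact
  interpret B: additive_subgroup B S by fact
  note sub = A.a_subset B.a_subset
  note [simp] = subsetD[OF A.a_subset] subsetD[OF B.a_subset] rng_m_closed
  have in_S: "prod_sums S A B \<subseteq> carrier S"
    by (rule prod_sums_subset[OF _ sub]) (auto intro!: additive_subgroup_intro)
  have add: "x \<oplus> y \<in> prod_sums S A B" if x: "x \<in> prod_sums S A B" and y: "y \<in> prod_sums S A B" for x y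
    using sub y
  proof (induction rule: prod_sums_induct)
    case zero
    then show ?case using x in_S by auto
  next
    case (add_mult y a b)
    then have "x \<oplus> (y \<oplus> a \<otimes> b) = (x \<oplus> y) \<oplus> a \<otimes> b"
      using x in_S by (simp add: a_assoc subset_iff)
    then show ?case using prod_sums_add_mult[OF sub add_mult(5,3,4)] by simp
  qed
  have minus: "\<ominus> x \<in> prod_sums S A B" if x: "x \<in> prod_sums S A B" for x
    using sub x
  proof (induction rule: prod_sums_induct)
    case zero
    have "\<ominus> \<zero> = \<zero>" by (rule minus_equality) simp_all
    then show ?case using prod_sums_zero by (simp only:)
  next
    case (add_mult x a b)
    then have "\<ominus> (x \<oplus> a \<otimes> b) = \<ominus> x \<oplus> (\<ominus> a) \<otimes> b"
      by (simp add: minus_add rng_l_minus)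
    then show ?case using prod_sums_add_mult[OF sub add_mult(5) _ add_mult(4)] add_mult(3) by simp
  qed
  show ?thesis
    by (rule additive_subgroup_intro) (use in_S add minus prod_sums_zero in auto)
qed

end

context graded_rng
begin

lemma component_subset: "g \<in> carrier G \<Longrightarrow> C g \<subseteq> carrier S"
  using component_subgroup additive_subgroup.a_subset by blast

lemma component_mult_closed:
  assumes "g \<in> carrier G" "h \<in> carrier G" "x \<in> C g" "y \<in> C h"
  shows "x \<otimes>\<^bsub>S\<^esub> y \<in> C (g \<otimes>\<^bsub>G\<^esub> h)"
  using component_mult[OF assms(1,2)] S.mult_in_prod_sums[OF _ _ assms(3,4)] component_subset assms
  by blast

text \<open>
  Closure under products holds because \<open>S\<^sub>g S\<^sub>h\<close> lies in the component of the neutral element, which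
  maps \<open>S\<^sub>h\<close> into itself: in \<open>(a b) y\<close> the factor \<open>b y\<close> is again in \<open>S\<^sub>h\<close>.
\<close>

lemma prod_sums_inverse_components_rng:
  assumes g: "g \<in> carrier G" and h: "h \<in> carrier G" and inverse: "h \<otimes>\<^bsub>G\<^esub> g = \<one>\<^bsub>G\<^esub>"
  shows "rng (S\<lparr>carrier := prod_sums S (C g) (C h)\<rparr>)"
proof (rule S.rng_restrict)
  let ?T = "prod_sums S (C g) (C h)"
  show T: "additive_subgroup ?T S"
    by (intro S.prod_sums_additive_subgroup component_subgroup g h)
  interpret T: additive_subgroup ?T S by fact
  note sub = component_subset[OF g] component_subset[OF h]
  have gh: "g \<otimes>\<^bsub>G\<^esub> h = \<one>\<^bsub>G\<^esub>" using inverse g h G.inv_comm by blast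
  fix x y assume x: "x \<in> ?T" and y: "y \<in> ?T"
  have yS: "y \<in> carrier S" using y T.a_subset by blast
  show "x \<otimes>\<^bsub>S\<^esub> y \<in> ?T"
    using sub x
  proof (induction rule: S.prod_sums_induct)
    case zero
    then show ?case using yS by simp
  next
    case (add_mult x a b)
    have ab: "a \<in> carrier S" "b \<in> carrier S" using add_mult sub by auto
    have "y \<in> C \<one>\<^bsub>G\<^esub>" using y component_mult[OF g h] gh by auto
    then have "b \<otimes>\<^bsub>S\<^esub> y \<in> C h"
      using component_mult_closed[OF h _ \<open>b \<in> C h\<close>, of "\<one>\<^bsub>G\<^esub>" y] h by simp
    then have "a \<otimes>\<^bsub>S\<^esub> (b \<otimes>\<^bsub>S\<^esub> y) \<in> ?T"
      using S.mult_in_prod_sums[OF sub] add_mult by blast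
    moreover have "(x \<oplus>\<^bsub>S\<^esub> a \<otimes>\<^bsub>S\<^esub> b) \<otimes>\<^bsub>S\<^esub> y = x \<otimes>\<^bsub>S\<^esub> y \<oplus>\<^bsub>S\<^esub> a \<otimes>\<^bsub>S\<^esub> (b \<otimes>\<^bsub>S\<^esub> y)"
      using add_mult ab yS by (simp add: S.rng_l_distr S.rng_m_assoc S.rng_m_closed)
    ultimately show ?case using add_mult by simp
  qed
qed

text \<open>
  The bimodule laws hold in every graded ring, so only the one-sided local units have to be found.
\<close>

lemma nearly_epsilon_strongly_gradedI:
  assumes left: "\<And>g x. \<lbrakk>g \<in> carrier G; x \<in> C g\<rbrakk> \<Longrightarrow>
      \<exists>t \<in> prod_sums S (C g) (C (inv\<^bsub>G\<^esub> g)). t \<otimes>\<^bsub>S\<^esub> x = x"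
    and right: "\<And>g x. \<lbrakk>g \<in> carrier G; x \<in> C g\<rbrakk> \<Longrightarrow>
      \<exists>t \<in> prod_sums S (C (inv\<^bsub>G\<^esub> g)) (C g). x \<otimes>\<^bsub>S\<^esub> t = x"
  shows "nearly_epsilon_strongly_graded G S C"
proof (intro nearly_epsilon_strongly_graded.intro graded_rng_axioms
    nearly_epsilon_strongly_graded_axioms.intro)
  fix g assume g: "g \<in> carrier G"
  let ?h = "inv\<^bsub>G\<^esub> g"
  let ?T = "prod_sums S (C g) (C ?h)" and ?T' = "prod_sums S (C ?h) (C g)"
  have h: "?h \<in> carrier G" using g by simp
  have T_one: "?T \<subseteq> C \<one>\<^bsub>G\<^esub>" and T'_one: "?T' \<subseteq> C \<one>\<^bsub>G\<^esub>"
    using component_mult[OF g h] component_mult[OF h g] g by auto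
  have T: "t \<in> carrier S" "x \<in> C g \<Longrightarrow> t \<otimes>\<^bsub>S\<^esub> x \<in> C g" if "t \<in> ?T" for t x
    using T_one that component_subset[of "\<one>\<^bsub>G\<^esub>"] component_mult_closed[of "\<one>\<^bsub>G\<^esub>" g t x] g by auto
  have T': "t \<in> carrier S" "x \<in> C g \<Longrightarrow> x \<otimes>\<^bsub>S\<^esub> t \<in> C g" if "t \<in> ?T'" for t x
    using T'_one that component_subset[of "\<one>\<^bsub>G\<^esub>"] component_mult_closed[of g "\<one>\<^bsub>G\<^esub>" x t] g by auto
  have C: "x \<in> carrier S" if "x \<in> C g" for x
    using component_subset[OF g] that by blast
  show "s_unital_bimodule (S\<lparr>carrier := ?T\<rparr>) (S\<lparr>carrier := ?T'\<rparr>) (S\<lparr>carrier := C g\<rparr>)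
      (\<lambda>t m. t \<otimes>\<^bsub>S\<^esub> m) (\<lambda>m t'. m \<otimes>\<^bsub>S\<^esub> t')"
  proof (intro s_unital_bimodule.intro rng_bimodule.intro s_unital_bimodule_axioms.intro)
    show "rng (S\<lparr>carrier := ?T\<rparr>)"
      using g h by (intro prod_sums_inverse_components_rng) simp_all
    show "rng (S\<lparr>carrier := ?T'\<rparr>)"
      using g h by (intro prod_sums_inverse_components_rng) simp_all
    show "abelian_group (S\<lparr>carrier := C g\<rparr>)"
      by (intro S.abelian_group_restrict component_subgroup g)
    show "rng_bimodule_axioms (S\<lparr>carrier := ?T\<rparr>) (S\<lparr>carrier := ?T'\<rparr>) (S\<lparr>carrier := C g\<rparr>)
      (\<lambda>t m. t \<otimes>\<^bsub>S\<^esub> m) (\<lambda>m t'. m \<otimes>\<^bsub>S\<^esub> t')"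
      by unfold_locales (simp_all add: T T' C S.rng_l_distr S.rng_r_distr S.rng_m_assoc)
    show "\<exists>t\<in>carrier (S\<lparr>carrier := ?T\<rparr>). \<exists>t'\<in>carrier (S\<lparr>carrier := ?T'\<rparr>). t \<otimes>\<^bsub>S\<^esub> x = x \<and> x = x \<otimes>\<^bsub>S\<^esub> t'"
      if "x \<in> carrier (S\<lparr>carrier := C g\<rparr>)" for x
      using left[OF g, of x] right[OF g, of x] that by simp metis
  qed
qed

end

text \<open>
  A decomposition of \<open>x\<close> into homogeneous components can only be \<open>g \<mapsto> pr g x\<close>, since applying the
  additive map \<open>pr g\<close> to the decomposition leaves its component at \<open>g\<close>. This gives uniqueness without
  comparing two finite sums with different supports.
\<close>

lemma graded_rng_by_projections:
  fixes G (structure) and S (structure)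
  assumes G: "group G" and S: "rng S"
    and subgroup: "\<And>g. g \<in> carrier G \<Longrightarrow> additive_subgroup (C g) S"
    and mult: "\<And>g h x y. \<lbrakk>g \<in> carrier G; h \<in> carrier G; x \<in> C g; y \<in> C h\<rbrakk> \<Longrightarrow>
      x \<otimes>\<^bsub>S\<^esub> y \<in> C (g \<otimes>\<^bsub>G\<^esub> h)"
    and pr_in: "\<And>g x. \<lbrakk>g \<in> carrier G; x \<in> carrier S\<rbrakk> \<Longrightarrow> pr g x \<in> C g"
    and pr_add: "\<And>g x y. \<lbrakk>g \<in> carrier G; x \<in> carrier S; y \<in> carrier S\<rbrakk> \<Longrightarrow>
      pr g (x \<oplus>\<^bsub>S\<^esub> y) = pr g x \<oplus>\<^bsub>S\<^esub> pr g y"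
    and pr_component: "\<And>g h x. \<lbrakk>g \<in> carrier G; h \<in> carrier G; x \<in> C g\<rbrakk> \<Longrightarrow>
      pr h x = (if h = g then x else \<zero>\<^bsub>S\<^esub>)"
    and pr_sum: "\<And>x. x \<in> carrier S \<Longrightarrow>
      \<exists>D \<subseteq> carrier G. finite D \<and> x = (\<Oplus>\<^bsub>S\<^esub>g\<in>D. pr g x)"
  shows "graded_rng G S C"
proof -
  interpret S: rng S by fact
  have C: "C g \<subseteq> carrier S" if "g \<in> carrier G" for g
    using subgroup[OF that] additive_subgroup.a_subset by blast
  have pr_zero: "pr g \<zero>\<^bsub>S\<^esub> = \<zero>\<^bsub>S\<^esub>" if "g \<in> carrier G" for g
    using pr_component[OF that that] additive_subgroup.zero_closed[OF subgroup[OF that]] by auto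
  have pr_finsum: "pr h (\<Oplus>\<^bsub>S\<^esub>g\<in>D. c g) = (if h \<in> D then c h else \<zero>\<^bsub>S\<^esub>)"
    if "finite D" "D \<subseteq> carrier G" "\<And>g. g \<in> D \<Longrightarrow> c g \<in> C g" "h \<in> carrier G" for D c h
    using that
  proof (induction D rule: finite_induct)
    case empty
    then show ?case by (simp add: pr_zero)
  next
    case (insert k D)
    have c: "c g \<in> carrier S" if "g \<in> insert k D" for g
      using insert.prems C that by blast
    have sum_D: "(\<Oplus>\<^bsub>S\<^esub>g\<in>D. c g) \<in> carrier S"
      using c by (intro S.finsum_closed) auto
    have "(\<Oplus>\<^bsub>S\<^esub>g\<in>insert k D. c g) = c k \<oplus>\<^bsub>S\<^esub> (\<Oplus>\<^bsub>S\<^esub>g\<in>D. c g)"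
      using insert.hyps c by (intro S.finsum_insert) auto
    then have "pr h (\<Oplus>\<^bsub>S\<^esub>g\<in>insert k D. c g) = pr h (c k) \<oplus>\<^bsub>S\<^esub> pr h (\<Oplus>\<^bsub>S\<^esub>g\<in>D. c g)"
      using c sum_D insert.prems(3) by (simp add: pr_add)
    then show ?case
      using insert c pr_component[of k h "c k"] by auto
  qed
  show ?thesis
  proof (intro graded_rng.intro graded_rng_axioms.intro G S subgroup)
    fix g h assume g: "g \<in> carrier G" and h: "h \<in> carrier G"
    have "g \<otimes> h \<in> carrier G"
      using G g h by (simp add: group.is_monoid monoid.m_closed)
    then show "prod_sums S (C g) (C h) \<subseteq> C (g \<otimes> h)"
      by (rule S.prod_sums_subset[OF subgroup C[OF g] C[OF h] mult[OF g h]])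
  next
    fix x assume x: "x \<in> carrier S"
    let ?nz = "\<lambda>c. {g \<in> carrier G. c g \<noteq> \<zero>\<^bsub>S\<^esub>}"
    let ?Q = "\<lambda>c. c \<in> (\<Pi>\<^sub>E g\<in>carrier G. C g) \<and> finite (?nz c) \<and> x = (\<Oplus>\<^bsub>S\<^esub>g\<in>?nz c. c g)"
    define c where "c = (\<lambda>g\<in>carrier G. pr g x)"
    have unique: "d = c" if d: "?Q d" for d
    proof (rule PiE_ext[of _ "carrier G" C])
      show "d \<in> (\<Pi>\<^sub>E g\<in>carrier G. C g)" using d by blast
      show "c \<in> (\<Pi>\<^sub>E g\<in>carrier G. C g)" using pr_in x by (auto simp: c_def)
      fix g assume g: "g \<in> carrier G"
      have "pr g x = pr g (\<Oplus>\<^bsub>S\<^esub>g\<in>?nz d. d g)" using d by simp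
      also have "\<dots> = (if g \<in> ?nz d then d g else \<zero>\<^bsub>S\<^esub>)"
        using d g by (intro pr_finsum) auto
      finally show "d g = c g" using g by (auto simp: c_def)
    qed
    obtain D where D: "D \<subseteq> carrier G" "finite D" and x_eq: "x = (\<Oplus>\<^bsub>S\<^esub>g\<in>D. pr g x)"
      using pr_sum[OF x] by blast
    have outside: "pr g x = \<zero>\<^bsub>S\<^esub>" if "g \<in> carrier G" "g \<notin> D" for g
      using pr_finsum[OF D(2,1) _ that(1), of "\<lambda>g. pr g x"] x_eq that D pr_in[OF _ x] by auto
    have nz: "?nz c \<subseteq> D" using outside by (auto simp: c_def)
    have pr_S: "pr g x \<in> carrier S" if "g \<in> D" for g
      using that D pr_in[OF _ x] C by blast
    have "(\<Oplus>\<^bsub>S\<^esub>g\<in>?nz c. c g) = (\<Oplus>\<^bsub>S\<^esub>g\<in>D. pr g x)"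
    proof (rule S.add.finprod_mono_neutral_cong_left)
      show "\<And>g. g \<in> D - ?nz c \<Longrightarrow> pr g x = \<zero>\<^bsub>S\<^esub>"
        using D by (auto simp: c_def)
      show "(\<lambda>g. pr g x) \<in> D \<rightarrow> carrier S" using pr_S by blast
    qed (use nz D in \<open>simp_all add: c_def\<close>)
    moreover have "c \<in> (\<Pi>\<^sub>E g\<in>carrier G. C g)" using pr_in[OF _ x] by (simp add: c_def)
    moreover have "finite (?nz c)" using nz D finite_subset by blast
    ultimately have "?Q c" using x_eq by metis
    then show "\<exists>!c. ?Q c" using unique by blast
  qed
qed

section \<open>The free algebra is a ring\<close>

definition scaled_word :: "('r, 'm) ring_scheme \<Rightarrow> 'r \<Rightarrow> 'x list \<Rightarrow> 'x list \<Rightarrow> 'r" where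
  "scaled_word R r u = (\<lambda>w. if w = u then r else \<zero>\<^bsub>R\<^esub>)"

text \<open>
  The product of the free algebra, here for functions with arbitrary support: the inductions below
  replace \<open>p\<close> by \<open>\<lambda>v. p (x # v)\<close>, which is easier to do without a carrier set to maintain.
\<close>

definition convolution :: "('r, 'm) ring_scheme \<Rightarrow> ('x list \<Rightarrow> 'r) \<Rightarrow> ('x list \<Rightarrow> 'r) \<Rightarrow> 'x list \<Rightarrow> 'r" where
  "convolution R p q = (\<lambda>w. \<Oplus>\<^bsub>R\<^esub>i\<in>{..length w}. p (take i w) \<otimes>\<^bsub>R\<^esub> q (drop i w))"

lemma free_algebra_simps:
  "carrier (free_algebra R X) = {p. (\<forall>w. p w \<in> carrier R) \<and> finite {w. p w \<noteq> \<zero>\<^bsub>R\<^esub>} \<and>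
     {w. p w \<noteq> \<zero>\<^bsub>R\<^esub>} \<subseteq> lists X}"
  "mult (free_algebra R X) = convolution R"
  "one (free_algebra R X) = scaled_word R \<one>\<^bsub>R\<^esub> []"
  "zero (free_algebra R X) = (\<lambda>w. \<zero>\<^bsub>R\<^esub>)"
  "add (free_algebra R X) = (\<lambda>p q w. p w \<oplus>\<^bsub>R\<^esub> q w)"
  by (simp_all add: free_algebra_def convolution_def[abs_def] scaled_word_def)

lemma monomial_eq_scaled_word: "monomial R u = scaled_word R \<one>\<^bsub>R\<^esub> u"
  by (simp add: monomial_def scaled_word_def)

context ring
begin

lemma convolution_closed:
  assumes "\<And>w. p w \<in> carrier R" "\<And>w. q w \<in> carrier R"
  shows "convolution R p q w \<in> carrier R"
  unfolding convolution_def using assms by (intro finsum_closed) simp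

lemma convolution_Nil:
  assumes "\<And>w. p w \<in> carrier R" "\<And>w. q w \<in> carrier R"
  shows "convolution R p q [] = p [] \<otimes> q []"
  using assms by (simp add: convolution_def)

text \<open>
  Splitting off the summand in which \<open>p\<close> takes the empty prefix. With \<open>convolution_Nil\<close> this describes
  the convolution by recursion on the word, so the ring laws follow by induction instead of by
  rearranging double sums.
\<close>

lemma convolution_Cons:
  assumes "\<And>w. p w \<in> carrier R" "\<And>w. q w \<in> carrier R"
  shows "convolution R p q (x # w) = p [] \<otimes> q (x # w) \<oplus> convolution R (\<lambda>v. p (x # v)) q w"
proof -
  let ?f = "\<lambda>i. p (take i (x # w)) \<otimes> q (drop i (x # w))"
  have "convolution R p q (x # w) = (\<Oplus>i\<in>{..Suc (length w)}. ?f i)"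
    by (simp add: convolution_def)
  also have "\<dots> = (\<Oplus>i\<in>{..length w}. ?f (Suc i)) \<oplus> ?f 0"
    using assms by (intro finsum_Suc2) simp
  also have "(\<Oplus>i\<in>{..length w}. ?f (Suc i)) = convolution R (\<lambda>v. p (x # v)) q w"
    by (simp add: convolution_def)
  finally show ?thesis
    using assms by (simp add: a_comm convolution_closed)
qed

lemma convolution_add_left:
  assumes "\<And>w. p w \<in> carrier R" "\<And>w. p' w \<in> carrier R" "\<And>w. q w \<in> carrier R"
  shows "convolution R (\<lambda>w. p w \<oplus> p' w) q w = convolution R p q w \<oplus> convolution R p' q w"
  using assms
  by (induction w arbitrary: p p')
    (simp_all add: convolution_Nil convolution_Cons convolution_closed l_distr a_ac)

lemma convolution_add_right:
  assumes "\<And>w. p w \<in> carrier R" "\<And>w. q w \<in> carrier R" "\<And>w. q' w \<in> carrier R"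
  shows "convolution R p (\<lambda>w. q w \<oplus> q' w) w = convolution R p q w \<oplus> convolution R p q' w"
  using assms
  by (induction w arbitrary: p)
    (simp_all add: convolution_Nil convolution_Cons convolution_closed r_distr a_ac)

lemma convolution_scale_left:
  assumes "a \<in> carrier R" "\<And>w. p w \<in> carrier R" "\<And>w. q w \<in> carrier R"
  shows "convolution R (\<lambda>w. a \<otimes> p w) q w = a \<otimes> convolution R p q w"
  using assms
  by (induction w arbitrary: p)
    (simp_all add: convolution_Nil convolution_Cons convolution_closed r_distr m_assoc)

lemma convolution_assoc:
  assumes "\<And>w. p w \<in> carrier R" "\<And>w. q w \<in> carrier R" "\<And>w. r w \<in> carrier R"
  shows "convolution R (convolution R p q) r w = convolution R p (convolution R q r) w"
  using assms
  by (induction w arbitrary: p q)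
    (simp_all add: convolution_Nil convolution_Cons convolution_closed convolution_add_left
      convolution_scale_left l_distr r_distr m_assoc a_assoc)

lemma convolution_zero_left:
  assumes "\<And>w. q w \<in> carrier R"
  shows "convolution R (\<lambda>w. \<zero>) q w = \<zero>"
  using assms by (induction w) (simp_all add: convolution_Nil convolution_Cons)

lemma convolution_nonzeroE:
  assumes "convolution R p q w \<noteq> \<zero>" "\<And>w. p w \<in> carrier R" "\<And>w. q w \<in> carrier R"
  obtains u v where "w = u @ v" "p u \<noteq> \<zero>" "q v \<noteq> \<zero>"
proof -
  have "\<exists>i. p (take i w) \<otimes> q (drop i w) \<noteq> \<zero>"
  proof (rule ccontr)
    assume "\<nexists>i. p (take i w) \<otimes> q (drop i w) \<noteq> \<zero>"
    then have "convolution R p q w = \<zero>" by (simp add: convolution_def)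
    with assms(1) show False by contradiction
  qed
  then obtain i where "p (take i w) \<otimes> q (drop i w) \<noteq> \<zero>" by blast
  then have "p (take i w) \<noteq> \<zero>" "q (drop i w) \<noteq> \<zero>" using assms by auto
  then show thesis using that[of "take i w" "drop i w"] by simp
qed

lemma convolution_scaled_word_left:
  assumes "r \<in> carrier R" "\<And>w. p w \<in> carrier R"
  shows "convolution R (scaled_word R r u) p w =
    (if take (length u) w = u then r \<otimes> p (drop (length u) w) else \<zero>)"
  using assms(2)
proof (induction u arbitrary: w)
  case Nil
  show ?case
  proof (cases w)
    case Nil
    then show ?thesis using assms by (simp add: convolution_Nil scaled_word_def)
  next
    case (Cons x w')
    then show ?thesis
      using assms by (simp add: convolution_Cons scaled_word_def convolution_zero_left)
  qed
next
  case (Cons y u)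
  show ?case
  proof (cases w)
    case Nil
    then show ?thesis using assms by (simp add: convolution_Nil scaled_word_def)
  next
    case (Cons x w')
    have "(\<lambda>v. scaled_word R r (y # u) (x # v)) = (if x = y then scaled_word R r u else (\<lambda>w. \<zero>))"
      by (auto simp: scaled_word_def)
    moreover have "scaled_word R r (y # u) v \<in> carrier R" for v
      using assms by (simp add: scaled_word_def)
    ultimately show ?thesis
      using assms Cons.IH[of w'] Cons
      by (simp add: convolution_Cons convolution_zero_left) (simp add: scaled_word_def)
  qed
qed

lemma convolution_one_right:
  assumes "\<And>w. p w \<in> carrier R"
  shows "convolution R p (scaled_word R \<one> []) w = p w"
  using assms
proof (induction w arbitrary: p)
  case Nil
  then show ?case by (subst convolution_Nil) (simp_all add: scaled_word_def)
next
  case (Cons x w)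
  then show ?case by (subst convolution_Cons) (simp_all add: scaled_word_def)
qed

lemma convolution_scaled_word_scaled_word:
  assumes "r \<in> carrier R" "s \<in> carrier R"
  shows "convolution R (scaled_word R r u) (scaled_word R s v) = scaled_word R (r \<otimes> s) (u @ v)"
proof
  fix w
  have "take (length u) w = u \<and> drop (length u) w = v \<longleftrightarrow> w = u @ v"
    by (metis append_eq_conv_conj)
  then show "convolution R (scaled_word R r u) (scaled_word R s v) w = scaled_word R (r \<otimes> s) (u @ v) w"
    using assms by (subst convolution_scaled_word_left) (auto simp: scaled_word_def)
qed

lemma scaled_word_in_free_algebra:
  "\<lbrakk>r \<in> carrier R; u \<in> lists X\<rbrakk> \<Longrightarrow> scaled_word R r u \<in> carrier (free_algebra R X)"
  by (auto simp: free_algebra_simps scaled_word_def)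

theorem free_algebra_is_ring: "ring (free_algebra R X)"
proof (rule ringI)
  let ?F = "free_algebra R X"
  have add_closed: "p \<oplus>\<^bsub>?F\<^esub> q \<in> carrier ?F" if "p \<in> carrier ?F" "q \<in> carrier ?F" for p q
  proof -
    have "{w. p w \<oplus> q w \<noteq> \<zero>} \<subseteq> {w. p w \<noteq> \<zero>} \<union> {w. q w \<noteq> \<zero>}" by auto
    then show ?thesis
      using that finite_subset by (fastforce simp: free_algebra_simps)
  qed
  show "abelian_group ?F"
  proof (rule abelian_groupI)
    fix p assume p: "p \<in> carrier ?F"
    show "\<exists>q\<in>carrier ?F. q \<oplus>\<^bsub>?F\<^esub> p = \<zero>\<^bsub>?F\<^esub>"
      using p by (intro bexI[of _ "\<lambda>w. \<ominus> p w"]) (auto simp: free_algebra_simps l_neg)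
  qed (use add_closed in \<open>auto simp: free_algebra_simps a_ac\<close>)
  have mult_closed: "p \<otimes>\<^bsub>?F\<^esub> q \<in> carrier ?F" if p: "p \<in> carrier ?F" and q: "q \<in> carrier ?F" for p q
  proof -
    have sub: "{w. convolution R p q w \<noteq> \<zero>} \<subseteq> (\<lambda>(u, v). u @ v) ` ({w. p w \<noteq> \<zero>} \<times> {w. q w \<noteq> \<zero>})"
      (is "_ \<subseteq> ?W")
    proof
      fix w assume "w \<in> {w. convolution R p q w \<noteq> \<zero>}"
      then obtain u v where "w = u @ v" "p u \<noteq> \<zero>" "q v \<noteq> \<zero>"
        using convolution_nonzeroE[of p q w] p q by (auto simp: free_algebra_simps)
      then show "w \<in> ?W" by auto
    qed
    moreover have "finite ?W" using p q by (auto simp: free_algebra_simps)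
    moreover have "?W \<subseteq> lists X" using p q by (fastforce simp: free_algebra_simps)
    ultimately show ?thesis
      using p q finite_subset[OF sub] by (auto simp: free_algebra_simps convolution_closed)
  qed
  show "monoid ?F"
  proof (rule monoidI)
    show "\<one>\<^bsub>?F\<^esub> \<in> carrier ?F"
      using scaled_word_in_free_algebra[of "\<one>" "[]" X] by (simp add: free_algebra_simps(3))
    show "p \<otimes>\<^bsub>?F\<^esub> q \<otimes>\<^bsub>?F\<^esub> r = p \<otimes>\<^bsub>?F\<^esub> (q \<otimes>\<^bsub>?F\<^esub> r)"
      if "p \<in> carrier ?F" "q \<in> carrier ?F" "r \<in> carrier ?F" for p q r
      using that unfolding free_algebra_simps by (intro ext convolution_assoc) simp_all
    show "\<one>\<^bsub>?F\<^esub> \<otimes>\<^bsub>?F\<^esub> p = p" if "p \<in> carrier ?F" for p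
      using that unfolding free_algebra_simps by (simp add: convolution_scaled_word_left fun_eq_iff)
    show "p \<otimes>\<^bsub>?F\<^esub> \<one>\<^bsub>?F\<^esub> = p" if "p \<in> carrier ?F" for p
      using that unfolding free_algebra_simps by (intro ext convolution_one_right) simp
  qed (rule mult_closed)
qed (simp_all add: free_algebra_simps convolution_add_left convolution_add_right fun_eq_iff)

text \<open>
  The induction principle behind all arguments that reduce a statement about the free algebra to
  single words. Only the words in the support of \<open>p\<close> have to be considered, which is what keeps track
  of the degree and of the finitely many words for which a common unit is needed.
\<close>

lemma free_algebra_sum_of_scaled_words:
  assumes p: "p \<in> carrier (free_algebra R X)"
    and zero: "\<zero>\<^bsub>free_algebra R X\<^esub> \<in> A"
    and add: "\<And>a b. \<lbrakk>a \<in> A; b \<in> A\<rbrakk> \<Longrightarrow> a \<oplus>\<^bsub>free_algebra R X\<^esub> b \<in> A"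
    and terms: "\<And>w. p w \<noteq> \<zero> \<Longrightarrow> scaled_word R (p w) w \<in> A"
  shows "p \<in> A"
proof -
  have "(\<lambda>w. if w \<in> W then p w else \<zero>) \<in> A" if "finite W" "W \<subseteq> {w. p w \<noteq> \<zero>}" for W
    using that
  proof (induction W rule: finite_induct)
    case empty
    then show ?case using zero by (simp add: free_algebra_simps)
  next
    case (insert u W)
    have "(\<lambda>w. if w \<in> insert u W then p w else \<zero>) =
        scaled_word R (p u) u \<oplus>\<^bsub>free_algebra R X\<^esub> (\<lambda>w. if w \<in> W then p w else \<zero>)"
      using insert.hyps p by (auto simp: free_algebra_simps scaled_word_def fun_eq_iff)
    then show ?case using insert add terms by auto
  qed
  from this[of "{w. p w \<noteq> \<zero>}"] have "(\<lambda>w. if w \<in> {w. p w \<noteq> \<zero>} then p w else \<zero>) \<in> A"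
    using p by (simp add: free_algebra_simps)
  moreover have "(\<lambda>w. if w \<in> {w. p w \<noteq> \<zero>} then p w else \<zero>) = p" by auto
  ultimately show ?thesis by simp
qed

end

section \<open>Words in a family of partial isometries\<close>

text \<open>
  In applications \<open>x\<close> is an edge, \<open>y\<close> its ghost edge and \<open>r\<close> the range vertex. A commutation of
  \<open>p\<close> with \<open>x b y\<close> is turned into one of \<open>y p x\<close> with \<open>b\<close>: the ghost edge is moved from one idempotent
  to the other, where it becomes an edge.
\<close>

lemma (in monoid) commute_with_compression:
  assumes carrier: "x \<in> carrier G" "y \<in> carrier G" "p \<in> carrier G" "b \<in> carrier G" "r \<in> carrier G"
    and yx: "y \<otimes> x = r" and xr: "x \<otimes> r = x" and ry: "r \<otimes> y = y"
    and rb: "r \<otimes> b = b \<otimes> r"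
    and comm: "p \<otimes> (x \<otimes> b \<otimes> y) = (x \<otimes> b \<otimes> y) \<otimes> p"
  shows "(y \<otimes> p \<otimes> x) \<otimes> b = b \<otimes> (y \<otimes> p \<otimes> x)"
proof -
  note [simp] = carrier
  have "(y \<otimes> p \<otimes> x) \<otimes> b = (y \<otimes> p \<otimes> (x \<otimes> r)) \<otimes> b" by (simp only: xr)
  also have "\<dots> = y \<otimes> p \<otimes> x \<otimes> (r \<otimes> b)" by (simp add: m_assoc)
  also have "\<dots> = y \<otimes> p \<otimes> x \<otimes> (b \<otimes> (y \<otimes> x))" by (simp only: rb yx)
  also have "\<dots> = y \<otimes> (p \<otimes> (x \<otimes> b \<otimes> y)) \<otimes> x" by (simp add: m_assoc)
  also have "\<dots> = y \<otimes> ((x \<otimes> b \<otimes> y) \<otimes> p) \<otimes> x" by (simp only: comm)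
  also have "\<dots> = (y \<otimes> x) \<otimes> b \<otimes> (y \<otimes> p \<otimes> x)" by (simp add: m_assoc)
  also have "\<dots> = b \<otimes> (r \<otimes> y) \<otimes> p \<otimes> x" by (simp add: yx rb) (simp add: m_assoc)
  also have "\<dots> = b \<otimes> (y \<otimes> p \<otimes> x)" by (simp only: ry) (simp add: m_assoc)
  finally show ?thesis .
qed

lemma (in monoid) commute_mult:
  assumes "a \<in> carrier G" "b \<in> carrier G" "c \<in> carrier G"
    and ac: "a \<otimes> c = c \<otimes> a" and bc: "b \<otimes> c = c \<otimes> b"
  shows "(a \<otimes> b) \<otimes> c = c \<otimes> (a \<otimes> b)"
  using assms by (metis m_assoc)

lemma (in monoid) conjugates_commute:
  assumes carrier: "x \<in> carrier G" "y \<in> carrier G" "p \<in> carrier G" "b \<in> carrier G" "r \<in> carrier G"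
    and yx: "y \<otimes> x = r" and rp: "r \<otimes> p = p \<otimes> r" and rb: "r \<otimes> b = b \<otimes> r"
    and comm: "p \<otimes> b = b \<otimes> p"
  shows "(x \<otimes> p \<otimes> y) \<otimes> (x \<otimes> b \<otimes> y) = (x \<otimes> b \<otimes> y) \<otimes> (x \<otimes> p \<otimes> y)"
proof -
  note [simp] = carrier
  have "(x \<otimes> p \<otimes> y) \<otimes> (x \<otimes> b \<otimes> y) = x \<otimes> p \<otimes> (y \<otimes> x) \<otimes> b \<otimes> y" by (simp add: m_assoc)
  also have "\<dots> = x \<otimes> (p \<otimes> b) \<otimes> r \<otimes> y" by (simp only: yx) (simp add: m_assoc rb)
  also have "\<dots> = x \<otimes> b \<otimes> (p \<otimes> r) \<otimes> y" by (simp only: comm) (simp add: m_assoc)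
  also have "\<dots> = x \<otimes> b \<otimes> (y \<otimes> x) \<otimes> p \<otimes> y" by (simp only: rp[symmetric] yx) (simp add: m_assoc)
  also have "\<dots> = (x \<otimes> b \<otimes> y) \<otimes> (x \<otimes> p \<otimes> y)" by (simp add: m_assoc)
  finally show ?thesis .
qed

lemma lpa_gens_iff [simp]:
  "Vert v \<in> lpa_gens E \<longleftrightarrow> v \<in> verts E"
  "Edge f \<in> lpa_gens E \<longleftrightarrow> f \<in> arcs E"
  "Ghost f \<in> lpa_gens E \<longleftrightarrow> f \<in> arcs E"
  by (auto simp: lpa_gens_def)

fun gen_adjoint :: "('v, 'e) lpa_gen \<Rightarrow> ('v, 'e) lpa_gen" where
  "gen_adjoint (Vert v) = Vert v"
| "gen_adjoint (Edge f) = Ghost f"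
| "gen_adjoint (Ghost f) = Edge f"

definition word_adjoint :: "('v, 'e) lpa_gen list \<Rightarrow> ('v, 'e) lpa_gen list" where
  "word_adjoint w = rev (map gen_adjoint w)"

lemma gen_adjoint_gens [simp]: "gen_adjoint x \<in> lpa_gens E \<longleftrightarrow> x \<in> lpa_gens E"
  by (cases x) (auto simp: lpa_gens_def)

lemma gen_adjoint_gen_adjoint [simp]: "gen_adjoint (gen_adjoint x) = x"
  by (cases x) auto

lemma word_adjoint_simps [simp]:
  "word_adjoint [] = []" "word_adjoint (x # w) = word_adjoint w @ [gen_adjoint x]"
  by (simp_all add: word_adjoint_def)

lemma word_adjoint_adjoint [simp]: "word_adjoint (word_adjoint w) = w"
  by (simp add: word_adjoint_def rev_map comp_def)

lemma word_adjoint_lists [simp]: "word_adjoint w \<in> lists (lpa_gens E) \<longleftrightarrow> w \<in> lists (lpa_gens E)"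
  by (auto simp: word_adjoint_def)

lemma word_adjoint_eq_Nil [simp]: "word_adjoint w = [] \<longleftrightarrow> w = []"
  by (simp add: word_adjoint_def)

lemma word_degree_simps [simp]:
  "word_degree [] = 0" "word_degree (x # w) = gen_degree x + word_degree w"
  "word_degree (u @ w) = word_degree u + word_degree w"
  by (simp_all add: word_degree_def)

lemma word_degree_adjoint [simp]: "word_degree (word_adjoint w) = - word_degree w"
proof (induction w)
  case (Cons x w)
  have "gen_degree (gen_adjoint x) = - gen_degree x" by (cases x) auto
  with Cons show ?case by simp
qed simp

text \<open>
  Moving a ghost edge to the other side of a commutation turns it into an edge. Ghost edges are
  therefore given a larger weight than edges, so that the total weight decreases.
\<close>

fun gen_weight :: "('v, 'e) lpa_gen \<Rightarrow> nat" where
  "gen_weight (Vert v) = 1"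
| "gen_weight (Edge f) = 1"
| "gen_weight (Ghost f) = 2"

text \<open>
  Elements of a unital ring that satisfy the relations of vertices, edges and ghost edges. The unit
  serves as the value of the empty word, which makes inductions on words start trivially.
\<close>

locale graph_family = ring Q + wf_digraph E
  for Q (structure) and E :: "('v, 'e) pre_digraph" +
  fixes gen :: "('v, 'e) lpa_gen \<Rightarrow> 'q"
  assumes gen_closed [simp]: "x \<in> lpa_gens E \<Longrightarrow> gen x \<in> carrier Q"
    and vert_vert: "\<lbrakk>u \<in> verts E; v \<in> verts E\<rbrakk> \<Longrightarrow>
      gen (Vert u) \<otimes> gen (Vert v) = (if u = v then gen (Vert v) else \<zero>)"
    and tail_edge: "f \<in> arcs E \<Longrightarrow> gen (Vert (tail E f)) \<otimes> gen (Edge f) = gen (Edge f)"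
    and edge_head: "f \<in> arcs E \<Longrightarrow> gen (Edge f) \<otimes> gen (Vert (head E f)) = gen (Edge f)"
    and head_ghost: "f \<in> arcs E \<Longrightarrow> gen (Vert (head E f)) \<otimes> gen (Ghost f) = gen (Ghost f)"
    and ghost_tail: "f \<in> arcs E \<Longrightarrow> gen (Ghost f) \<otimes> gen (Vert (tail E f)) = gen (Ghost f)"
    and ghost_edge: "\<lbrakk>f \<in> arcs E; f' \<in> arcs E\<rbrakk> \<Longrightarrow>
      gen (Ghost f) \<otimes> gen (Edge f') = (if f = f' then gen (Vert (head E f)) else \<zero>)"
begin

primrec word :: "('v, 'e) lpa_gen list \<Rightarrow> 'q" where
  "word [] = \<one>"
| "word (x # w) = gen x \<otimes> word w"

lemma word_closed [simp]: "w \<in> lists (lpa_gens E) \<Longrightarrow> word w \<in> carrier Q"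
  by (induction w) auto

lemma word_append:
  "\<lbrakk>u \<in> lists (lpa_gens E); w \<in> lists (lpa_gens E)\<rbrakk> \<Longrightarrow> word (u @ w) = word u \<otimes> word w"
  by (induction u) (auto simp: m_assoc)

definition range_proj :: "('v, 'e) lpa_gen list \<Rightarrow> 'q" where
  "range_proj w = word w \<otimes> word (word_adjoint w)"

lemma range_proj_closed [simp]: "w \<in> lists (lpa_gens E) \<Longrightarrow> range_proj w \<in> carrier Q"
  by (simp add: range_proj_def)

lemma range_proj_Nil [simp]: "range_proj [] = \<one>"
  by (simp add: range_proj_def)

lemma range_proj_Cons:
  "\<lbrakk>x \<in> lpa_gens E; w \<in> lists (lpa_gens E)\<rbrakk> \<Longrightarrow>
    range_proj (x # w) = gen x \<otimes> range_proj w \<otimes> gen (gen_adjoint x)"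
  by (simp add: range_proj_def word_append m_assoc)

text \<open>
  A vertex either fixes a generator or annihilates it, and it acts in the same way on the adjoint from
  the other side. Hence vertices commute with all \<open>w w\<^sup>*\<close>.
\<close>

lemma vert_gen_cases:
  assumes v: "v \<in> verts E" and x: "x \<in> lpa_gens E"
  obtains (absorb) "gen (Vert v) \<otimes> gen x = gen x"
      "gen (gen_adjoint x) \<otimes> gen (Vert v) = gen (gen_adjoint x)"
    | (kill) "gen (Vert v) \<otimes> gen x = \<zero>" "gen (gen_adjoint x) \<otimes> gen (Vert v) = \<zero>"
proof (cases x)
  case (Vert u)
  then show ?thesis using x v absorb kill by (cases "u = v") (simp_all add: vert_vert)
next
  case (Edge f)
  then have f: "f \<in> arcs E" using x by simp
  show ?thesis
  proof (cases "v = tail E f")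
    case True
    then show ?thesis using absorb Edge f by (simp add: tail_edge ghost_tail)
  next
    case False
    have "gen (Vert v) \<otimes> gen (Edge f) = (gen (Vert v) \<otimes> gen (Vert (tail E f))) \<otimes> gen (Edge f)"
      using f v by (simp add: m_assoc tail_edge)
    moreover have "gen (Ghost f) \<otimes> gen (Vert v) =
        gen (Ghost f) \<otimes> (gen (Vert (tail E f)) \<otimes> gen (Vert v))"
      using f v by (simp add: m_assoc[symmetric] ghost_tail)
    ultimately show ?thesis using False kill Edge f v by (simp add: vert_vert)
  qed
next
  case (Ghost f)
  then have f: "f \<in> arcs E" using x by simp
  show ?thesis
  proof (cases "v = head E f")
    case True
    then show ?thesis using absorb Ghost f by (simp add: head_ghost edge_head)
  next
    case False
    have "gen (Vert v) \<otimes> gen (Ghost f) = (gen (Vert v) \<otimes> gen (Vert (head E f))) \<otimes> gen (Ghost f)"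
      using f v by (simp add: m_assoc head_ghost)
    moreover have "gen (Edge f) \<otimes> gen (Vert v) =
        gen (Edge f) \<otimes> (gen (Vert (head E f)) \<otimes> gen (Vert v))"
      using f v by (simp add: m_assoc[symmetric] edge_head)
    ultimately show ?thesis using False kill Ghost f v by (simp add: vert_vert)
  qed
qed

lemma vert_commutes_range_proj:
  assumes v: "v \<in> verts E" and w: "w \<in> lists (lpa_gens E)"
  shows "gen (Vert v) \<otimes> range_proj w = range_proj w \<otimes> gen (Vert v)"
proof (cases w)
  case Nil
  then show ?thesis using v by simp
next
  case (Cons x w')
  with w have x: "x \<in> lpa_gens E" and w': "w' \<in> lists (lpa_gens E)" by auto
  have "gen (Vert v) \<otimes> range_proj w =
      (gen (Vert v) \<otimes> gen x) \<otimes> range_proj w' \<otimes> gen (gen_adjoint x)"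
    using v x w' by (simp add: Cons range_proj_Cons m_assoc)
  also have "\<dots> = gen x \<otimes> range_proj w' \<otimes> (gen (gen_adjoint x) \<otimes> gen (Vert v))"
    using v x by (rule vert_gen_cases) (use x w' in simp_all)
  also have "\<dots> = range_proj w \<otimes> gen (Vert v)"
    using v x w' by (simp add: Cons range_proj_Cons m_assoc)
  finally show ?thesis .
qed

text \<open>
  By induction on the total weight of the two words, looking at their first letters. A vertex
  commutes with the idempotent of every word and can be dropped; a ghost edge is moved to the other word as an edge;
  two equal edges cancel through \<open>f\<^sup>* f\<close>, and two different edges make both products vanish.
\<close>

lemma range_proj_commute:
  assumes "u \<in> lists (lpa_gens E)" "w \<in> lists (lpa_gens E)"
  shows "range_proj u \<otimes> range_proj w = range_proj w \<otimes> range_proj u"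
  using assms
proof (induction "sum_list (map gen_weight u) + sum_list (map gen_weight w)"
    arbitrary: u w rule: less_induct)
  case less
  have strip_vert: "range_proj u \<otimes> range_proj w = range_proj w \<otimes> range_proj u"
    if "u = Vert v # u'" and uw: "u \<in> lists (lpa_gens E)" "w \<in> lists (lpa_gens E)"
      and IH: "range_proj u' \<otimes> range_proj w = range_proj w \<otimes> range_proj u'" for u w v u'
    using that vert_commutes_range_proj[of v w]
    by (simp add: range_proj_Cons commute_mult)
  have strip_ghost: "range_proj u \<otimes> range_proj w = range_proj w \<otimes> range_proj u"
    if "u = Ghost f # u'" and uw: "u \<in> lists (lpa_gens E)" "w \<in> lists (lpa_gens E)"
      and IH: "range_proj u' \<otimes> range_proj (Edge f # w) = range_proj (Edge f # w) \<otimes> range_proj u'"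
    for u w f u'
  proof -
    have "(gen (Ghost f) \<otimes> range_proj u' \<otimes> gen (Edge f)) \<otimes> range_proj w =
        range_proj w \<otimes> (gen (Ghost f) \<otimes> range_proj u' \<otimes> gen (Edge f))"
    proof (rule commute_with_compression)
      show "gen (Ghost f) \<otimes> gen (Edge f) = gen (Vert (head E f))"
        using that by (simp add: ghost_edge)
      show "range_proj u' \<otimes> (gen (Edge f) \<otimes> range_proj w \<otimes> gen (Ghost f)) =
          (gen (Edge f) \<otimes> range_proj w \<otimes> gen (Ghost f)) \<otimes> range_proj u'"
        using IH that by (simp add: range_proj_Cons)
    qed (use that in \<open>simp_all add: edge_head head_ghost vert_commutes_range_proj\<close>)
    then show ?thesis using that by (simp add: range_proj_Cons)
  qed
  show ?case
  proof (cases "u = [] \<or> w = []")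
    case True
    then show ?thesis using less.prems[THEN range_proj_closed] by (elim disjE) simp_all
  next
    case False
    then obtain x u' y w' where u: "u = x # u'" and w: "w = y # w'"
      by (meson neq_Nil_conv)
    have in_gens: "x \<in> lpa_gens E" "y \<in> lpa_gens E" "u' \<in> lists (lpa_gens E)" "w' \<in> lists (lpa_gens E)"
      using less.prems u w by auto
    consider (vert_left) v where "x = Vert v" | (ghost_left) f where "x = Ghost f"
      | (vert_right) v where "y = Vert v" | (ghost_right) f where "y = Ghost f"
      | (edges) f f' where "x = Edge f" "y = Edge f'"
      by (cases x; cases y) auto
    then show ?thesis
    proof cases
      case vert_left
      then show ?thesis
        using strip_vert[of u v u' w] less.hyps[of u' w] less.prems u in_gens by simp
    next
      case ghost_left
      then show ?thesis
        using strip_ghost[of u f u' w] less.hyps[of u' "Edge f # w"] less.prems u in_gens by simp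
    next
      case vert_right
      then show ?thesis
        using strip_vert[of w v w' u] less.hyps[of u w'] less.prems w in_gens by simp
    next
      case ghost_right
      then show ?thesis
        using strip_ghost[of w f w' u] less.hyps[of "Edge f # u" w'] less.prems w in_gens by simp
    next
      case edges
      have f: "f \<in> arcs E" "f' \<in> arcs E" using edges in_gens by auto
      show ?thesis
      proof (cases "f = f'")
        case True
        have "range_proj u' \<otimes> range_proj w' = range_proj w' \<otimes> range_proj u'"
          using less.hyps[of u' w'] u w edges in_gens by simp
        then have "(gen (Edge f) \<otimes> range_proj u' \<otimes> gen (Ghost f)) \<otimes> (gen (Edge f) \<otimes> range_proj w' \<otimes> gen (Ghost f)) =
            (gen (Edge f) \<otimes> range_proj w' \<otimes> gen (Ghost f)) \<otimes> (gen (Edge f) \<otimes> range_proj u' \<otimes> gen (Ghost f))"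
          using f in_gens
          by (intro conjugates_commute[where r = "gen (Vert (head E f))"])
            (simp_all add: ghost_edge vert_commutes_range_proj)
        then show ?thesis using True u w edges f in_gens by (simp add: range_proj_Cons)
      next
        case False
        have orth: "(gen (Edge g) \<otimes> a \<otimes> gen (Ghost g)) \<otimes> (gen (Edge h) \<otimes> b \<otimes> gen (Ghost h)) = \<zero>"
          if "a \<in> carrier Q" "b \<in> carrier Q" "g \<in> arcs E" "h \<in> arcs E" "g \<noteq> h" for a b g h
        proof -
          have "(gen (Edge g) \<otimes> a \<otimes> gen (Ghost g)) \<otimes> (gen (Edge h) \<otimes> b \<otimes> gen (Ghost h)) =
              gen (Edge g) \<otimes> a \<otimes> (gen (Ghost g) \<otimes> gen (Edge h)) \<otimes> b \<otimes> gen (Ghost h)"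
            using that by (simp add: m_assoc)
          then show ?thesis using that by (simp add: ghost_edge)
        qed
        show ?thesis
          using False u w edges f in_gens by (simp add: range_proj_Cons orth)
      qed
    qed
  qed
qed

text \<open>
  In the inductive step \<open>x w w\<^sup>* x\<^sup>* x w\<close>, the idempotent \<open>x\<^sup>* x\<close> is of the form \<open>u u\<^sup>*\<close> for the one-letter
  word \<open>u = x\<^sup>*\<close>, hence it can be moved past \<open>w w\<^sup>*\<close>; then \<open>x x\<^sup>* x = x\<close> and \<open>w w\<^sup>* w = w\<close>
  finish the proof.
\<close>

lemma word_adjoint_word:
  assumes "w \<in> lists (lpa_gens E)"
  shows "word w \<otimes> word (word_adjoint w) \<otimes> word w = word w"
  using assms
proof (induction w)
  case (Cons x w)
  let ?a = "gen x" and ?b = "gen (gen_adjoint x)"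
  have x: "x \<in> lpa_gens E" and w: "w \<in> lists (lpa_gens E)" using Cons.hyps by auto
  note [simp] = x w
  have IH: "range_proj w \<otimes> word w = word w" using Cons.IH w by (simp add: range_proj_def)
  have "range_proj [gen_adjoint x] \<otimes> range_proj w = range_proj w \<otimes> range_proj [gen_adjoint x]"
    by (intro range_proj_commute w) simp
  then have comm: "(?b \<otimes> ?a) \<otimes> range_proj w = range_proj w \<otimes> (?b \<otimes> ?a)"
    by (simp add: range_proj_Cons)
  have aba: "?a \<otimes> (?b \<otimes> ?a) = ?a"
  proof (cases x)
    case (Ghost f)
    then have "?a \<otimes> (?b \<otimes> ?a) = (gen (Ghost f) \<otimes> gen (Edge f)) \<otimes> gen (Ghost f)"
      using x by (simp add: m_assoc)
    then show ?thesis using x Ghost by (simp add: ghost_edge head_ghost)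
  qed (use x in \<open>simp_all add: vert_vert ghost_edge edge_head\<close>)
  have "word (x # w) \<otimes> word (word_adjoint (x # w)) \<otimes> word (x # w) =
      ?a \<otimes> (range_proj w \<otimes> (?b \<otimes> ?a)) \<otimes> word w"
    by (simp add: range_proj_def word_append m_assoc)
  also have "\<dots> = (?a \<otimes> (?b \<otimes> ?a)) \<otimes> (range_proj w \<otimes> word w)"
    by (simp only: comm[symmetric]) (simp add: m_assoc)
  also have "\<dots> = word (x # w)" by (simp only: aba IH word.simps)
  finally show ?case .
qed simp

lemma range_proj_word: "w \<in> lists (lpa_gens E) \<Longrightarrow> range_proj w \<otimes> word w = word w"
  using word_adjoint_word by (simp add: range_proj_def)

lemma word_range_proj_adjoint:
  "w \<in> lists (lpa_gens E) \<Longrightarrow> word w \<otimes> range_proj (word_adjoint w) = word w"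
  using word_adjoint_word by (simp add: range_proj_def m_assoc)

lemma range_proj_idem:
  "w \<in> lists (lpa_gens E) \<Longrightarrow> range_proj w \<otimes> range_proj w = range_proj w"
  using range_proj_word[of w] by (metis range_proj_def m_assoc range_proj_closed word_adjoint_lists word_closed)

text \<open>
  The idempotents of the words in \<open>W\<close> are joined one after the other to \<open>e + t - t e\<close>. The invariant
  that \<open>t\<close> commutes with the idempotent of every word, not just of those in \<open>W\<close>, is needed for
  the next join.
\<close>

lemma range_proj_common_unit:
  assumes "finite W" "W \<subseteq> lists (lpa_gens E)"
    and T: "T \<subseteq> carrier Q" "\<zero> \<in> T" "\<And>a b. \<lbrakk>a \<in> T; b \<in> T\<rbrakk> \<Longrightarrow> a \<oplus> b \<in> T"
      "\<And>a. a \<in> T \<Longrightarrow> \<ominus> a \<in> T" "\<And>a b. \<lbrakk>a \<in> T; b \<in> T\<rbrakk> \<Longrightarrow> a \<otimes> b \<in> T"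
    and "\<And>w. w \<in> W \<Longrightarrow> range_proj w \<in> T"
  shows "\<exists>t\<in>T. (\<forall>u\<in>lists (lpa_gens E). t \<otimes> range_proj u = range_proj u \<otimes> t) \<and>
    (\<forall>w\<in>W. t \<otimes> range_proj w = range_proj w)"
  using assms(1,2,8)
proof (induction W rule: finite_induct)
  case empty
  then show ?case using T(2) by (intro bexI[of _ \<zero>]) auto
next
  case (insert v W)
  then obtain t where t: "t \<in> T"
    and comm: "\<And>u. u \<in> lists (lpa_gens E) \<Longrightarrow> t \<otimes> range_proj u = range_proj u \<otimes> t"
    and unit: "\<And>w. w \<in> W \<Longrightarrow> t \<otimes> range_proj w = range_proj w"
    by auto
  let ?e = "range_proj v"
  have e: "?e \<in> T" and v: "v \<in> lists (lpa_gens E)" using insert.prems by auto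
  have [simp]: "t \<in> carrier Q" "?e \<in> carrier Q" using t e T(1) by auto
  define t' where "t' = ?e \<oplus> (t \<oplus> \<ominus> (t \<otimes> ?e))"
  have t'_mult: "t' \<otimes> p = ?e \<otimes> p \<oplus> (t \<otimes> p \<oplus> \<ominus> (t \<otimes> (?e \<otimes> p)))" if "p \<in> carrier Q" for p
    using that by (simp add: t'_def l_distr l_minus m_assoc)
  show ?case
  proof (intro bexI[of _ t'] conjI ballI)
    show "t' \<in> T" unfolding t'_def using t e by (intro T)
    fix u assume u: "u \<in> lists (lpa_gens E)"
    have pe: "range_proj u \<otimes> ?e = ?e \<otimes> range_proj u" using u v by (rule range_proj_commute)
    have "range_proj u \<otimes> (t \<otimes> ?e) = t \<otimes> (?e \<otimes> range_proj u)"
      using u pe comm[OF u] by (metis \<open>t \<in> carrier Q\<close> \<open>?e \<in> carrier Q\<close> m_assoc range_proj_closed)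
    then show "t' \<otimes> range_proj u = range_proj u \<otimes> t'"
      using u pe comm[OF u] by (simp add: t'_mult) (simp add: t'_def r_distr r_minus)
  next
    fix w assume w: "w \<in> insert v W"
    show "t' \<otimes> range_proj w = range_proj w"
    proof (cases "w = v")
      case True
      then show ?thesis using v by (simp add: t'_mult range_proj_idem r_neg)
    next
      case False
      then have w: "w \<in> W" "w \<in> lists (lpa_gens E)" using w insert.prems by auto
      have "t \<otimes> (?e \<otimes> range_proj w) = t \<otimes> range_proj w \<otimes> ?e"
        using w v by (simp add: range_proj_commute m_assoc)
      also have "\<dots> = ?e \<otimes> range_proj w"
        using w v by (simp add: unit range_proj_commute)
      finally have "t' \<otimes> range_proj w = ?e \<otimes> range_proj w \<oplus> (range_proj w \<oplus> \<ominus> (?e \<otimes> range_proj w))"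
        using w by (simp add: t'_mult unit)
      also have "\<dots> = range_proj w"
        using w by (simp add: a_lcomm[of "?e \<otimes> range_proj w"] r_neg)
      finally show ?thesis .
    qed
  qed
qed

end

section \<open>Homogeneous relations\<close>

definition homogeneous ::
    "('r, 'm) ring_scheme \<Rightarrow> int \<Rightarrow> (('v, 'e) lpa_gen list \<Rightarrow> 'r) \<Rightarrow> bool" where
  "homogeneous R n p \<longleftrightarrow> (\<forall>w. p w \<noteq> \<zero>\<^bsub>R\<^esub> \<longrightarrow> word_degree w = n)"

definition degree_part ::
    "('r, 'm) ring_scheme \<Rightarrow> int \<Rightarrow> (('v, 'e) lpa_gen list \<Rightarrow> 'r) \<Rightarrow> ('v, 'e) lpa_gen list \<Rightarrow> 'r" where
  "degree_part R n p = (\<lambda>w. if word_degree w = n then p w else \<zero>\<^bsub>R\<^esub>)"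

lemma homogeneous_degree_part: "homogeneous R n (degree_part R n p)"
  by (simp add: homogeneous_def degree_part_def)

lemma degree_part_homogeneous:
  "homogeneous R n p \<Longrightarrow> degree_part R m p = (if m = n then p else (\<lambda>w. \<zero>\<^bsub>R\<^esub>))"
  unfolding homogeneous_def degree_part_def by (intro ext) (auto, metis)

lemma homogeneous_scaled_word: "homogeneous R (word_degree u) (scaled_word R r u)"
  by (simp add: homogeneous_def scaled_word_def)

lemma homogeneous_zero: "homogeneous R n (\<lambda>w. \<zero>\<^bsub>R\<^esub>)"
  by (simp add: homogeneous_def)

context ring
begin

lemma a_inv_free_algebra:
  assumes "p \<in> carrier (free_algebra R X)"
  shows "\<ominus>\<^bsub>free_algebra R X\<^esub> p = (\<lambda>w. \<ominus> p w)"
proof -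
  interpret F: ring "free_algebra R X" by (rule free_algebra_is_ring)
  show ?thesis
    using assms by (intro F.minus_equality) (auto simp: free_algebra_simps l_neg)
qed

lemma homogeneous_add:
  "\<lbrakk>homogeneous R n p; homogeneous R n q\<rbrakk> \<Longrightarrow> homogeneous R n (\<lambda>w. p w \<oplus> q w)"
  unfolding homogeneous_def by (metis l_zero zero_closed)

lemma homogeneous_a_inv:
  assumes "p \<in> carrier (free_algebra R X)" "homogeneous R n p"
  shows "homogeneous R n (\<ominus>\<^bsub>free_algebra R X\<^esub> p)"
proof -
  have "\<ominus> \<zero> = \<zero>" by (rule minus_equality) simp_all
  with assms(2) show ?thesis
    unfolding homogeneous_def a_inv_free_algebra[OF assms(1)] by metis
qed

lemma degree_part_closed:
  assumes "p \<in> carrier (free_algebra R X)"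
  shows "degree_part R n p \<in> carrier (free_algebra R X)"
proof -
  have "{w. degree_part R n p w \<noteq> \<zero>} \<subseteq> {w. p w \<noteq> \<zero>}"
    by (auto simp: degree_part_def)
  moreover have "degree_part R n p w \<in> carrier R" for w
    using assms by (simp add: degree_part_def free_algebra_simps)
  ultimately show ?thesis
    using assms finite_subset by (auto simp: free_algebra_simps)
qed

lemma degree_part_add:
  "degree_part R n (p \<oplus>\<^bsub>free_algebra R X\<^esub> q) =
    degree_part R n p \<oplus>\<^bsub>free_algebra R X\<^esub> degree_part R n q"
  by (auto simp: free_algebra_simps degree_part_def fun_eq_iff)

lemma homogeneous_mult:
  assumes "p \<in> carrier (free_algebra R X)" "q \<in> carrier (free_algebra R X)"
    and "homogeneous R n p" "homogeneous R m q"
  shows "homogeneous R (n + m) (p \<otimes>\<^bsub>free_algebra R X\<^esub> q)"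
  unfolding homogeneous_def
proof (intro allI impI)
  fix w assume "(p \<otimes>\<^bsub>free_algebra R X\<^esub> q) w \<noteq> \<zero>"
  then obtain u v where "w = u @ v" "p u \<noteq> \<zero>" "q v \<noteq> \<zero>"
    using convolution_nonzeroE[of p q w] assms(1,2) by (auto simp: free_algebra_simps)
  then show "word_degree w = n + m" using assms(3,4) by (simp add: homogeneous_def)
qed

text \<open>
  Where \<open>q\<close> does not vanish on the suffix of \<open>w\<close>, that suffix has degree \<open>d\<close>, so \<open>w\<close> has degree
  \<open>n\<close> exactly if the prefix has degree \<open>n - d\<close>. The identity thus holds summand by summand.
\<close>

lemma degree_part_mult_homogeneous:
  assumes "p \<in> carrier (free_algebra R X)" "q \<in> carrier (free_algebra R X)" "homogeneous R d q"
  shows "degree_part R n (p \<otimes>\<^bsub>free_algebra R X\<^esub> q) =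
    degree_part R (n - d) p \<otimes>\<^bsub>free_algebra R X\<^esub> q"
proof
  fix w
  have [simp]: "p u \<in> carrier R" "q u \<in> carrier R" for u
    using assms by (auto simp: free_algebra_simps)
  have coeff: "degree_part R (n - d) p (take i w) \<otimes> q (drop i w) =
      (if word_degree w = n then p (take i w) \<otimes> q (drop i w) else \<zero>)" for i
  proof (cases "q (drop i w) = \<zero>")
    case False
    then have "word_degree (drop i w) = d" using assms(3) by (simp add: homogeneous_def)
    moreover have "word_degree w = word_degree (take i w) + word_degree (drop i w)"
      by (metis append_take_drop_id word_degree_simps(3))
    ultimately show ?thesis by (simp add: degree_part_def)
  qed (simp add: degree_part_def)
  show "degree_part R n (p \<otimes>\<^bsub>free_algebra R X\<^esub> q) w = (degree_part R (n - d) p \<otimes>\<^bsub>free_algebra R X\<^esub> q) w"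
    by (simp add: free_algebra_simps convolution_def coeff) (simp add: degree_part_def)
qed

lemma degree_part_homogeneous_mult:
  assumes "p \<in> carrier (free_algebra R X)" "q \<in> carrier (free_algebra R X)" "homogeneous R d q"
  shows "degree_part R n (q \<otimes>\<^bsub>free_algebra R X\<^esub> p) =
    q \<otimes>\<^bsub>free_algebra R X\<^esub> degree_part R (n - d) p"
proof
  fix w
  have [simp]: "p u \<in> carrier R" "q u \<in> carrier R" for u
    using assms by (auto simp: free_algebra_simps)
  have coeff: "q (take i w) \<otimes> degree_part R (n - d) p (drop i w) =
      (if word_degree w = n then q (take i w) \<otimes> p (drop i w) else \<zero>)" for i
  proof (cases "q (take i w) = \<zero>")
    case False
    then have "word_degree (take i w) = d" using assms(3) by (simp add: homogeneous_def)
    moreover have "word_degree w = word_degree (take i w) + word_degree (drop i w)"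
      by (metis append_take_drop_id word_degree_simps(3))
    ultimately show ?thesis by (simp add: degree_part_def)
  qed (simp add: degree_part_def)
  show "degree_part R n (q \<otimes>\<^bsub>free_algebra R X\<^esub> p) w = (q \<otimes>\<^bsub>free_algebra R X\<^esub> degree_part R (n - d) p) w"
    by (simp add: free_algebra_simps convolution_def coeff) (simp add: degree_part_def)
qed

text \<open>
  The elements all of whose homogeneous parts lie in the ideal form an ideal themselves, and it
  contains the generators.
\<close>

lemma degree_part_in_homogeneous_ideal:
  fixes X :: "('v, 'e) lpa_gen set"
  assumes B: "B \<subseteq> carrier (free_algebra R X)"
    and hom: "\<And>b. b \<in> B \<Longrightarrow> \<exists>n. homogeneous R n b"
    and p: "p \<in> Idl\<^bsub>free_algebra R X\<^esub> B"
  shows "degree_part R n p \<in> Idl\<^bsub>free_algebra R X\<^esub> B"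
proof -
  let ?F = "free_algebra R X"
  interpret F: ring ?F by (rule free_algebra_is_ring)
  let ?I = "Idl\<^bsub>?F\<^esub> B"
  interpret I: ideal ?I ?F by (rule F.genideal_ideal[OF B])
  define J where "J = {p \<in> carrier ?F. \<forall>n. degree_part R n p \<in> ?I}"
  have zero: "degree_part R n \<zero>\<^bsub>?F\<^esub> = \<zero>\<^bsub>?F\<^esub>" for n
    by (simp add: degree_part_def free_algebra_simps)
  have J_add: "p \<oplus>\<^bsub>?F\<^esub> q \<in> J" if "p \<in> J" "q \<in> J" for p q
    using that unfolding J_def by (auto simp: degree_part_add)
  have J_zero: "\<zero>\<^bsub>?F\<^esub> \<in> J" by (simp add: J_def zero)
  have J_sub: "J \<subseteq> carrier ?F" by (auto simp: J_def)
  have single: "scaled_word R (a w) w \<in> carrier ?F"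
    if "a \<in> carrier ?F" "a w \<noteq> \<zero>" for a w
    using that by (intro scaled_word_in_free_algebra) (auto simp: free_algebra_simps)
  have left: "a \<otimes>\<^bsub>?F\<^esub> p \<in> J" if p: "p \<in> J" and a: "a \<in> carrier ?F" for p a
  proof -
    have "a \<in> {a \<in> carrier ?F. a \<otimes>\<^bsub>?F\<^esub> p \<in> J}"
    proof (rule free_algebra_sum_of_scaled_words[OF a])
      fix w assume w: "a w \<noteq> \<zero>"
      have "degree_part R n (scaled_word R (a w) w \<otimes>\<^bsub>?F\<^esub> p) =
          scaled_word R (a w) w \<otimes>\<^bsub>?F\<^esub> degree_part R (n - word_degree w) p" for n
        using p J_sub single[OF a w]
        by (intro degree_part_homogeneous_mult homogeneous_scaled_word) auto
      then show "scaled_word R (a w) w \<in> {a \<in> carrier ?F. a \<otimes>\<^bsub>?F\<^esub> p \<in> J}"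
        using p single[OF a w] by (auto simp: J_def I.I_l_closed)
    qed (use p J_sub J_zero J_add in \<open>auto simp: F.l_distr subset_iff\<close>)
    then show ?thesis by simp
  qed
  have right: "p \<otimes>\<^bsub>?F\<^esub> a \<in> J" if p: "p \<in> J" and a: "a \<in> carrier ?F" for p a
  proof -
    have "a \<in> {a \<in> carrier ?F. p \<otimes>\<^bsub>?F\<^esub> a \<in> J}"
    proof (rule free_algebra_sum_of_scaled_words[OF a])
      fix w assume w: "a w \<noteq> \<zero>"
      have "degree_part R n (p \<otimes>\<^bsub>?F\<^esub> scaled_word R (a w) w) =
          degree_part R (n - word_degree w) p \<otimes>\<^bsub>?F\<^esub> scaled_word R (a w) w" for n
        using p J_sub single[OF a w]
        by (intro degree_part_mult_homogeneous homogeneous_scaled_word) auto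
      then show "scaled_word R (a w) w \<in> {a \<in> carrier ?F. p \<otimes>\<^bsub>?F\<^esub> a \<in> J}"
        using p single[OF a w] by (auto simp: J_def I.I_r_closed)
    qed (use p J_sub J_zero J_add in \<open>auto simp: F.r_distr subset_iff\<close>)
    then show ?thesis by simp
  qed
  \<comment> \<open>Negatives come from multiplication by \<open>- 1\<close> in the free algebra.\<close>
  have J_minus: "\<ominus>\<^bsub>?F\<^esub> p \<in> J" if "p \<in> J" for p
    using left[OF that, of "\<ominus>\<^bsub>?F\<^esub> \<one>\<^bsub>?F\<^esub>"] that J_sub by (auto simp: F.l_minus)
  have "ideal J ?F"
    by (intro idealI F.ring_axioms F.add.subgroupI left right)
      (use J_sub J_zero J_add J_minus in auto)
  moreover have "B \<subseteq> J"
  proof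
    fix b assume b: "b \<in> B"
    obtain m where m: "homogeneous R m b" using hom[OF b] by blast
    have "degree_part R n b \<in> ?I" for n
    proof -
      have "degree_part R n b = (if n = m then b else \<zero>\<^bsub>?F\<^esub>)"
        using degree_part_homogeneous[OF m, of n] by (simp add: free_algebra_simps(4))
      then show ?thesis using F.genideal_self[OF B] b by auto
    qed
    then show "b \<in> J" using b B by (auto simp: J_def)
  qed
  ultimately have "?I \<subseteq> J" by (rule F.genideal_minimal)
  with p show ?thesis by (auto simp: J_def)
qed

end

text \<open>
  The quotient \<open>Q\<close> of the unital free algebra \<open>F\<close> is a ring with unit that contains the Leavitt path
  algebra \<open>L\<close> as the image of the non-unital free algebra \<open>N\<close>. Calculations take place in \<open>Q\<close>, where
  the standard theory of rings applies.
\<close>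

locale leavitt = ring R + wf_digraph E
  for R (structure) and E :: "('v, 'e) pre_digraph"
begin

abbreviation F where "F \<equiv> lpa_free R E"
abbreviation I where "I \<equiv> lpa_ideal R E"
abbreviation Q where "Q \<equiv> F Quot I"
abbreviation L where "L \<equiv> leavitt_path_algebra R E"
abbreviation N where "N \<equiv> free_nonunital R (lpa_gens E)"
abbreviation cls where "cls p \<equiv> I +>\<^bsub>F\<^esub> p"

sublocale F: ring F by (rule free_algebra_is_ring)

lemma monomial_closed: "w \<in> lists (lpa_gens E) \<Longrightarrow> monomial R w \<in> carrier F"
  by (simp add: monomial_eq_scaled_word scaled_word_in_free_algebra)

lemma homogeneous_monomial: "homogeneous R (word_degree w) (monomial R w)"
  by (simp add: monomial_eq_scaled_word homogeneous_scaled_word)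

lemma edge_ghost_sum_homogeneous:
  assumes "finite A" "A \<subseteq> arcs E"
  shows "(\<Oplus>\<^bsub>F\<^esub>f\<in>A. monomial R [Edge f, Ghost f]) \<in> {p \<in> carrier F. homogeneous R 0 p}"
  using assms
proof (induction A rule: finite_induct)
  case empty
  have "homogeneous R 0 \<zero>\<^bsub>F\<^esub>" by (simp add: free_algebra_simps(4) homogeneous_zero)
  then show ?case by simp
next
  case (insert f A)
  have closed: "monomial R [Edge g, Ghost g] \<in> carrier F" if "g \<in> insert f A" for g
    using that insert.prems by (intro monomial_closed) auto
  have f: "homogeneous R 0 (monomial R [Edge f, Ghost f])"
    using homogeneous_monomial[of "[Edge f, Ghost f]"] by simp
  have "(\<Oplus>\<^bsub>F\<^esub>f\<in>insert f A. monomial R [Edge f, Ghost f]) =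
      monomial R [Edge f, Ghost f] \<oplus>\<^bsub>F\<^esub> (\<Oplus>\<^bsub>F\<^esub>f\<in>A. monomial R [Edge f, Ghost f])"
    using insert.hyps closed by (intro F.finsum_insert) auto
  moreover have "homogeneous R 0 (\<dots>)"
    using f insert.IH insert.prems unfolding free_algebra_simps(5) by (intro homogeneous_add) auto
  moreover have "(\<Oplus>\<^bsub>F\<^esub>f\<in>insert f A. monomial R [Edge f, Ghost f]) \<in> carrier F"
    using closed by (intro F.finsum_closed) auto
  ultimately show ?case by simp
qed

lemma lpa_relations_homogeneous:
  assumes "(a, b) \<in> lpa_relations R E"
  shows "a \<in> carrier F \<and> b \<in> carrier F \<and> (\<exists>n. homogeneous R n a \<and> homogeneous R n b)"
proof -
  have mono: "monomial R u \<in> carrier F \<and> monomial R w \<in> carrier F \<and>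
      (\<exists>n. homogeneous R n (monomial R u) \<and> homogeneous R n (monomial R w))"
    if "u \<in> lists (lpa_gens E)" "w \<in> lists (lpa_gens E)" "word_degree u = word_degree w"
    for u w :: "('v, 'e) lpa_gen list"
    using that homogeneous_monomial[of u] homogeneous_monomial[of w] monomial_closed by auto
  have mono_zero: "monomial R u \<in> carrier F \<and> \<zero>\<^bsub>F\<^esub> \<in> carrier F \<and>
      (\<exists>n. homogeneous R n (monomial R u) \<and> homogeneous R n \<zero>\<^bsub>F\<^esub>)"
    if "u \<in> lists (lpa_gens E)" for u :: "('v, 'e) lpa_gen list"
    using that homogeneous_monomial[of u] monomial_closed homogeneous_zero[of R "word_degree u"] F.zero_closed
    by (auto simp: free_algebra_simps(4))
  show ?thesis
    using assms
  proof cases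
    case (edge_ghost_sum v)
    have "homogeneous R 0 (monomial R [Vert v])"
      using homogeneous_monomial[of "[Vert v]"] by simp
    moreover have "monomial R [Vert v] \<in> carrier F"
      using edge_ghost_sum by (intro monomial_closed) simp
    moreover have "out_arcs E v \<subseteq> arcs E" by auto
    ultimately show ?thesis
      using edge_ghost_sum edge_ghost_sum_homogeneous[of "out_arcs E v"] by auto
  qed (simp_all only:, (rule mono mono_zero; simp)+)
qed

abbreviation relators where
  "relators \<equiv> {a \<ominus>\<^bsub>F\<^esub> b | a b. (a, b) \<in> lpa_relations R E}"

lemma relators_closed: "relators \<subseteq> carrier F"
  using lpa_relations_homogeneous by blast

lemma relators_homogeneous:
  assumes "p \<in> relators"
  shows "\<exists>n. homogeneous R n p"
proof -
  obtain a b where p: "p = a \<ominus>\<^bsub>F\<^esub> b" and ab: "(a, b) \<in> lpa_relations R E"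
    using assms by blast
  then obtain n where "b \<in> carrier F" "homogeneous R n a" "homogeneous R n b"
    using lpa_relations_homogeneous by blast
  then have "homogeneous R n (\<lambda>w. a w \<oplus> (\<ominus>\<^bsub>F\<^esub> b) w)"
    by (intro homogeneous_add homogeneous_a_inv)
  then show ?thesis by (auto simp: p a_minus_def free_algebra_simps(5))
qed

sublocale I: ideal I F
  unfolding lpa_ideal_def by (rule F.genideal_ideal[OF relators_closed])

sublocale Q: ring Q by (rule I.quotient_is_ring)

sublocale quot: ring_hom_ring F Q "\<lambda>p. cls p" by (rule I.rcos_ring_hom_ring)

lemma cls_eq_iff:
  "\<lbrakk>p \<in> carrier F; q \<in> carrier F\<rbrakk> \<Longrightarrow> cls p = cls q \<longleftrightarrow> p \<ominus>\<^bsub>F\<^esub> q \<in> I"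
  using F.quotient_eq_iff_same_a_r_cos[OF I.ideal_axioms] by simp

lemma relation_holds:
  assumes "(a, b) \<in> lpa_relations R E"
  shows "cls a = cls b"
proof -
  have "a \<ominus>\<^bsub>F\<^esub> b \<in> relators" using assms by blast
  then have "a \<ominus>\<^bsub>F\<^esub> b \<in> I"
    unfolding lpa_ideal_def using F.genideal_self[OF relators_closed] by blast
  then show ?thesis using lpa_relations_homogeneous[OF assms] cls_eq_iff by blast
qed

lemma degree_part_ideal: "p \<in> I \<Longrightarrow> degree_part R n p \<in> I"
  unfolding lpa_ideal_def
  by (rule degree_part_in_homogeneous_ideal[OF relators_closed relators_homogeneous])

lemma monomial_append:
  "monomial R (u @ w) = monomial R u \<otimes>\<^bsub>F\<^esub> monomial R w"
  by (simp add: monomial_eq_scaled_word free_algebra_simps convolution_scaled_word_scaled_word)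

lemma cls_monomial_append:
  "\<lbrakk>u \<in> lists (lpa_gens E); w \<in> lists (lpa_gens E)\<rbrakk> \<Longrightarrow>
    cls (monomial R (u @ w)) = cls (monomial R u) \<otimes>\<^bsub>Q\<^esub> cls (monomial R w)"
  by (simp add: monomial_append monomial_closed)

sublocale words: graph_family Q E "\<lambda>x. cls (monomial R [x])"
proof (intro graph_family.intro graph_family_axioms.intro Q.ring_axioms wf_digraph_axioms)
  have pair: "cls (monomial R [x]) \<otimes>\<^bsub>Q\<^esub> cls (monomial R [y]) = cls (monomial R [x, y])"
    if "x \<in> lpa_gens E" "y \<in> lpa_gens E" for x y
    using cls_monomial_append[of "[x]" "[y]"] that by simp
  show "cls (monomial R [x]) \<in> carrier Q" if "x \<in> lpa_gens E" for x
    using that by (simp add: monomial_closed)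
  show "cls (monomial R [Vert u]) \<otimes>\<^bsub>Q\<^esub> cls (monomial R [Vert v]) =
      (if u = v then cls (monomial R [Vert v]) else \<zero>\<^bsub>Q\<^esub>)"
    if "u \<in> verts E" "v \<in> verts E" for u v
    using that relation_holds[OF vert_idem[of v E R]] relation_holds[OF vert_orth[of u E v R]]
    by (auto simp: pair)
  fix f assume f: "f \<in> arcs E"
  then have [simp]: "tail E f \<in> verts E" "head E f \<in> verts E" by auto
  show "cls (monomial R [Vert (tail E f)]) \<otimes>\<^bsub>Q\<^esub> cls (monomial R [Edge f]) = cls (monomial R [Edge f])"
    using f relation_holds[OF source_edge[OF f]] by (simp add: pair)
  show "cls (monomial R [Edge f]) \<otimes>\<^bsub>Q\<^esub> cls (monomial R [Vert (head E f)]) = cls (monomial R [Edge f])"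
    using f relation_holds[OF edge_range[OF f]] by (simp add: pair)
  show "cls (monomial R [Vert (head E f)]) \<otimes>\<^bsub>Q\<^esub> cls (monomial R [Ghost f]) = cls (monomial R [Ghost f])"
    using f relation_holds[OF range_ghost[OF f]] by (simp add: pair)
  show "cls (monomial R [Ghost f]) \<otimes>\<^bsub>Q\<^esub> cls (monomial R [Vert (tail E f)]) = cls (monomial R [Ghost f])"
    using f relation_holds[OF ghost_source[OF f]] by (simp add: pair)
  show "cls (monomial R [Ghost f]) \<otimes>\<^bsub>Q\<^esub> cls (monomial R [Edge f']) =
      (if f = f' then cls (monomial R [Vert (head E f)]) else \<zero>\<^bsub>Q\<^esub>)" if "f' \<in> arcs E" for f'
    using f that relation_holds[OF ghost_edge_same[OF f]] relation_holds[OF ghost_edge_diff[OF f that]]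
    by (auto simp: pair)
qed

lemma word_eq_cls: "w \<in> lists (lpa_gens E) \<Longrightarrow> words.word w = cls (monomial R w)"
proof (induction w rule: list.induct)
  case Nil
  have "monomial R [] = \<one>\<^bsub>F\<^esub>" by (simp add: monomial_eq_scaled_word free_algebra_simps)
  then show ?case by simp
next
  case (Cons x w)
  then show ?case using cls_monomial_append[of "[x]" w] by simp
qed

end

section \<open>Grading and local units of the Leavitt path algebra\<close>

lemma (in ring) is_rng: "rng R"
  by unfold_locales (simp_all add: m_assoc l_distr r_distr)

context leavitt
begin

lemma free_nonunital_iff: "p \<in> N \<longleftrightarrow> p \<in> carrier F \<and> p [] = \<zero>"
  by (simp add: free_nonunital_def)

lemma free_nonunital_carrier: "p \<in> N \<Longrightarrow> p \<in> carrier F"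
  by (simp add: free_nonunital_def)

lemma free_nonunital_closed:
  shows "\<zero>\<^bsub>F\<^esub> \<in> N"
    and "\<lbrakk>p \<in> N; q \<in> N\<rbrakk> \<Longrightarrow> p \<oplus>\<^bsub>F\<^esub> q \<in> N"
    and "\<lbrakk>p \<in> N; q \<in> N\<rbrakk> \<Longrightarrow> p \<otimes>\<^bsub>F\<^esub> q \<in> N"
    and "p \<in> N \<Longrightarrow> \<ominus>\<^bsub>F\<^esub> p \<in> N"
proof -
  show "\<zero>\<^bsub>F\<^esub> \<in> N" by (simp add: free_nonunital_iff) (simp add: free_algebra_simps(4))
  show "p \<oplus>\<^bsub>F\<^esub> q \<in> N" if "p \<in> N" "q \<in> N"
    using that by (simp add: free_nonunital_iff) (simp add: free_algebra_simps(5))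
  show "p \<otimes>\<^bsub>F\<^esub> q \<in> N" if "p \<in> N" "q \<in> N"
  proof -
    have "p w \<in> carrier R" "q w \<in> carrier R" for w
      using that by (auto simp: free_nonunital_iff free_algebra_simps(1))
    then have "(p \<otimes>\<^bsub>F\<^esub> q) [] = \<zero>"
      using that by (simp add: free_algebra_simps(2) convolution_Nil free_nonunital_iff)
    then show ?thesis using that by (simp add: free_nonunital_iff)
  qed
  have "\<ominus> \<zero> = \<zero>" by (rule minus_equality) simp_all
  then show "\<ominus>\<^bsub>F\<^esub> p \<in> N" if "p \<in> N"
    using that unfolding free_nonunital_iff by (metis F.a_inv_closed a_inv_free_algebra)
qed

lemma leavitt_path_algebra_eq: "L = Q\<lparr>carrier := (\<lambda>p. cls p) ` N\<rparr>"
  by (simp add: leavitt_path_algebra_def Setcompr_eq_image)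

lemma L_simps [simp]:
  "carrier L = (\<lambda>p. cls p) ` N" "mult L = mult Q" "add L = add Q" "zero L = zero Q"
  by (simp_all add: leavitt_path_algebra_eq)

lemma cls_image_additive_subgroup:
  assumes "P \<subseteq> carrier F" "\<zero>\<^bsub>F\<^esub> \<in> P" "\<And>p q. \<lbrakk>p \<in> P; q \<in> P\<rbrakk> \<Longrightarrow> p \<oplus>\<^bsub>F\<^esub> q \<in> P"
    "\<And>p. p \<in> P \<Longrightarrow> \<ominus>\<^bsub>F\<^esub> p \<in> P"
  shows "additive_subgroup ((\<lambda>p. cls p) ` P) Q"
proof (rule rng.additive_subgroup_intro[OF Q.is_rng])
  have hom: "cls p \<oplus>\<^bsub>Q\<^esub> cls q = cls (p \<oplus>\<^bsub>F\<^esub> q)" "\<ominus>\<^bsub>Q\<^esub> cls p = cls (\<ominus>\<^bsub>F\<^esub> p)"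
    if "p \<in> P" "q \<in> P" for p q
    using that assms(1) by (auto simp: subset_iff)
  show "\<zero>\<^bsub>Q\<^esub> \<in> (\<lambda>p. cls p) ` P" using assms(2) quot.hom_zero by (metis imageI)
  show "x \<oplus>\<^bsub>Q\<^esub> y \<in> (\<lambda>p. cls p) ` P" if "x \<in> (\<lambda>p. cls p) ` P" "y \<in> (\<lambda>p. cls p) ` P" for x y
    using that assms(3) hom(1) by fast
  show "\<ominus>\<^bsub>Q\<^esub> x \<in> (\<lambda>p. cls p) ` P" if "x \<in> (\<lambda>p. cls p) ` P" for x
    using that assms(4) hom(2) by fast
qed (use assms(1) quot.hom_closed in blast)

lemma L_rng: "rng L"
  unfolding leavitt_path_algebra_eq
proof (rule rng.rng_restrict[OF Q.is_rng])
  show "additive_subgroup ((\<lambda>p. cls p) ` N) Q"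
    using free_nonunital_carrier free_nonunital_closed
    by (intro cls_image_additive_subgroup) auto
  have "cls p \<otimes>\<^bsub>Q\<^esub> cls q = cls (p \<otimes>\<^bsub>F\<^esub> q)" if "p \<in> N" "q \<in> N" for p q
    using that free_nonunital_carrier by simp
  then show "x \<otimes>\<^bsub>Q\<^esub> y \<in> (\<lambda>p. cls p) ` N" if "x \<in> (\<lambda>p. cls p) ` N" "y \<in> (\<lambda>p. cls p) ` N" for x y
    using that free_nonunital_closed(3) by fast
qed

sublocale L: rng L by (rule L_rng)

lemma L_subset_Q: "x \<in> carrier L \<Longrightarrow> x \<in> carrier Q"
  using free_nonunital_carrier by auto

lemma L_a_inv: "x \<in> carrier L \<Longrightarrow> \<ominus>\<^bsub>L\<^esub> x = \<ominus>\<^bsub>Q\<^esub> x"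
  using L.l_neg[of x] L.a_inv_closed[of x] L_subset_Q
  by (metis L_simps(3,4) Q.minus_equality)

definition homogeneous_polys :: "int \<Rightarrow> (('v, 'e) lpa_gen list \<Rightarrow> 'a) set" where
  "homogeneous_polys n = {p \<in> N. homogeneous R n p}"

lemma leavitt_grading_eq: "leavitt_grading R E n = (\<lambda>p. cls p) ` homogeneous_polys n"
  by (auto simp: leavitt_grading_def homogeneous_polys_def homogeneous_def)

lemma leavitt_grading_subgroup: "additive_subgroup (leavitt_grading R E n) L"
proof -
  have "\<zero>\<^bsub>F\<^esub> \<in> homogeneous_polys n"
    using free_nonunital_closed(1)
    by (simp add: homogeneous_polys_def) (simp add: free_algebra_simps(4) homogeneous_zero)
  moreover have "p \<oplus>\<^bsub>F\<^esub> q \<in> homogeneous_polys n"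
    if "p \<in> homogeneous_polys n" "q \<in> homogeneous_polys n" for p q
    using that free_nonunital_closed(2)[of p q] homogeneous_add[of n p q]
    by (simp add: homogeneous_polys_def free_algebra_simps(5))
  moreover have "\<ominus>\<^bsub>F\<^esub> p \<in> homogeneous_polys n" if "p \<in> homogeneous_polys n" for p
    using that free_nonunital_closed(4)[of p] homogeneous_a_inv[OF free_nonunital_carrier, of p n]
    by (simp add: homogeneous_polys_def)
  ultimately interpret additive_subgroup "leavitt_grading R E n" Q
    unfolding leavitt_grading_eq
    by (intro cls_image_additive_subgroup) (auto simp: homogeneous_polys_def free_nonunital_carrier)
  have sub: "leavitt_grading R E n \<subseteq> carrier L"
    by (auto simp: leavitt_grading_eq homogeneous_polys_def)
  then have "\<ominus>\<^bsub>L\<^esub> x \<in> leavitt_grading R E n" if "x \<in> leavitt_grading R E n" for x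
    using that L_a_inv[of x] a_inv_closed[of x] Q.abelian_group_axioms by auto
  with sub show ?thesis
    by (intro L.additive_subgroup_intro) auto
qed

text \<open>
  The union consists of copies of a single coset, as \<open>coset_degree_part_cls\<close> shows; this avoids the
  choice of a representative.
\<close>

definition coset_degree_part ::
    "int \<Rightarrow> (('v, 'e) lpa_gen list \<Rightarrow> 'a) set \<Rightarrow> (('v, 'e) lpa_gen list \<Rightarrow> 'a) set" where
  "coset_degree_part n X = (\<Union>p\<in>X. cls (degree_part R n p))"

lemma coset_degree_part_cls:
  assumes p: "p \<in> carrier F"
  shows "coset_degree_part n (cls p) = cls (degree_part R n p)"
proof -
  have cls_zero: "cls h = \<zero>\<^bsub>Q\<^esub>" if "h \<in> I" for h
    using that I.a_rcos_const unfolding FactRing_def by (simp only: ring.simps)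
  have "cls (degree_part R n q) = cls (degree_part R n p)" if qp: "q \<in> cls p" for q
  proof -
    obtain h where h: "h \<in> I" and q: "q = h \<oplus>\<^bsub>F\<^esub> p"
      using qp unfolding a_r_coset_def' by blast
    have "cls (degree_part R n q) = cls (degree_part R n h) \<oplus>\<^bsub>Q\<^esub> cls (degree_part R n p)"
      using p h I.Icarr by (simp add: q degree_part_add degree_part_closed)
    then show ?thesis
      using p h by (simp add: cls_zero degree_part_ideal degree_part_closed)
  qed
  moreover have "p \<in> cls p" using p by (rule I.a_rcos_self)
  then have "cls p \<noteq> {}" by blast
  ultimately show ?thesis
    unfolding coset_degree_part_def by (intro SUP_eq_const)
qed

lemma sum_degree_parts:
  assumes p: "p \<in> N" and "finite D"
  shows "(\<Oplus>\<^bsub>L\<^esub>n\<in>D. cls (degree_part R n p)) = cls (\<lambda>w. if word_degree w \<in> D then p w else \<zero>)"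
proof -
  have part: "degree_part R n p \<in> N" for n
    using p degree_part_closed[of p "lpa_gens E" n]
    by (auto simp: free_nonunital_iff degree_part_def)
  have "(\<Oplus>\<^bsub>L\<^esub>n\<in>D. cls (degree_part R n p)) = cls (\<lambda>w. if word_degree w \<in> D then p w else \<zero>) \<and>
      (\<lambda>w. if word_degree w \<in> D then p w else \<zero>) \<in> N"
    using \<open>finite D\<close>
  proof (induction D rule: finite_induct)
    case empty
    have "(\<lambda>w. \<zero>) = \<zero>\<^bsub>F\<^esub>" by (simp add: free_algebra_simps(4))
    then show ?case using free_nonunital_closed(1) quot.hom_zero by simp
  next
    case (insert m D)
    let ?q = "\<lambda>w. if word_degree w \<in> D then p w else \<zero>"
    have q: "?q \<in> N" using insert.IH by blast
    have split: "(\<lambda>w. if word_degree w \<in> insert m D then p w else \<zero>) = degree_part R m p \<oplus>\<^bsub>F\<^esub> ?q"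
      using p insert.hyps
      by (auto simp: free_algebra_simps(1,5) free_nonunital_iff degree_part_def fun_eq_iff)
    have "(\<Oplus>\<^bsub>L\<^esub>n\<in>insert m D. cls (degree_part R n p)) = cls (degree_part R m p) \<oplus>\<^bsub>L\<^esub> cls ?q"
      using insert part by (subst L.finsum_insert) auto
    then show ?case
      unfolding split using q part free_nonunital_closed(2) free_nonunital_carrier by simp
  qed
  then show ?thesis by blast
qed

theorem leavitt_path_algebra_graded: "graded_rng integer_group L (leavitt_grading R E)"
proof (rule graded_rng_by_projections[where pr = coset_degree_part])
  show "rng L" by (rule L_rng)
  show "group integer_group" by simp
  show "additive_subgroup (leavitt_grading R E n) L" for n by (rule leavitt_grading_subgroup)
  have homD: "p \<in> carrier F" "p \<in> N" "homogeneous R n p" if "p \<in> homogeneous_polys n" for p n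
    using that by (auto simp: homogeneous_polys_def free_nonunital_carrier)
  show "x \<otimes>\<^bsub>L\<^esub> y \<in> leavitt_grading R E (n \<otimes>\<^bsub>integer_group\<^esub> m)"
    if x: "x \<in> leavitt_grading R E n" and y: "y \<in> leavitt_grading R E m" for n m x y
  proof -
    obtain p q where p: "p \<in> homogeneous_polys n" "x = cls p" and q: "q \<in> homogeneous_polys m" "y = cls q"
      using x y unfolding leavitt_grading_eq by blast
    have "p \<otimes>\<^bsub>F\<^esub> q \<in> homogeneous_polys (n + m)"
      using free_nonunital_closed(3)[OF homD(2)[OF p(1)] homD(2)[OF q(1)]]
        homogeneous_mult[OF homD(1)[OF p(1)] homD(1)[OF q(1)] homD(3)[OF p(1)] homD(3)[OF q(1)]]
      by (simp only: homogeneous_polys_def mem_Collect_eq)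
    moreover have "x \<otimes>\<^bsub>L\<^esub> y = cls (p \<otimes>\<^bsub>F\<^esub> q)" using p q homD by simp
    ultimately show ?thesis by (simp add: leavitt_grading_eq)
  qed
  show "coset_degree_part n x \<in> leavitt_grading R E n" if "x \<in> carrier L" for n x
  proof -
    obtain p where p: "p \<in> N" "x = cls p" using \<open>x \<in> carrier L\<close> by auto
    have "degree_part R n p \<in> homogeneous_polys n"
      using p degree_part_closed[of p "lpa_gens E" n]
      by (auto simp: homogeneous_polys_def homogeneous_degree_part free_nonunital_iff) (simp add: degree_part_def)
    then show ?thesis
      using p by (simp add: coset_degree_part_cls free_nonunital_carrier leavitt_grading_eq)
  qed
  show "coset_degree_part n (x \<oplus>\<^bsub>L\<^esub> y) = coset_degree_part n x \<oplus>\<^bsub>L\<^esub> coset_degree_part n y"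
    if "x \<in> carrier L" "y \<in> carrier L" for n x y
  proof -
    obtain p q where pq: "p \<in> N" "q \<in> N" and xy: "x = cls p" "y = cls q" using \<open>x \<in> carrier L\<close> \<open>y \<in> carrier L\<close> by auto
    note [simp] = pq[THEN free_nonunital_carrier]
    have "x \<oplus>\<^bsub>L\<^esub> y = cls (p \<oplus>\<^bsub>F\<^esub> q)" by (simp add: xy)
    then show ?thesis
      by (simp add: xy coset_degree_part_cls degree_part_add degree_part_closed del: quot.hom_add)
        (simp add: degree_part_closed)
  qed
  show "coset_degree_part m x = (if m = n then x else \<zero>\<^bsub>L\<^esub>)" if x: "x \<in> leavitt_grading R E n" for n m x
  proof -
    obtain p where p: "p \<in> homogeneous_polys n" "x = cls p" using x unfolding leavitt_grading_eq by blast
    have "degree_part R m p = (if m = n then p else \<zero>\<^bsub>F\<^esub>)"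
      using degree_part_homogeneous[OF homD(3)[OF p(1)], of m] by (simp add: free_algebra_simps(4))
    then show ?thesis using p homD by (simp add: coset_degree_part_cls)
  qed
  show "\<exists>D\<subseteq>carrier integer_group. finite D \<and> x = (\<Oplus>\<^bsub>L\<^esub>n\<in>D. coset_degree_part n x)"
    if "x \<in> carrier L" for x
  proof -
    obtain p where p: "p \<in> N" "x = cls p" using \<open>x \<in> carrier L\<close> by auto
    let ?D = "word_degree ` {w. p w \<noteq> \<zero>}"
    have fin: "finite ?D" using p by (simp add: free_nonunital_iff free_algebra_simps(1))
    have "(\<lambda>w. if word_degree w \<in> ?D then p w else \<zero>) = p" by (auto simp: fun_eq_iff)
    then have "(\<Oplus>\<^bsub>L\<^esub>n\<in>?D. cls (degree_part R n p)) = x"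
      using sum_degree_parts[OF p(1) fin] p(2) by simp
    then show ?thesis
      using p fin by (intro exI[of _ ?D]) (simp add: coset_degree_part_cls free_nonunital_carrier)
  qed
qed

sublocale graded: graded_rng integer_group L "leavitt_grading R E"
  by (rule leavitt_path_algebra_graded)

lemma cls_monomial_in_grading:
  assumes "w \<in> lists (lpa_gens E)" "w \<noteq> []"
  shows "cls (monomial R w) \<in> leavitt_grading R E (word_degree w)"
proof -
  have "monomial R w [] = \<zero>" using assms by (simp add: monomial_def)
  then have "monomial R w \<in> homogeneous_polys (word_degree w)"
    using assms monomial_closed homogeneous_monomial
    by (simp add: homogeneous_polys_def free_nonunital_iff)
  then show ?thesis unfolding leavitt_grading_eq by blast
qed

lemma range_proj_in_prod_sums:
  assumes w: "w \<in> lists (lpa_gens E)" "w \<noteq> []" and n: "word_degree w = n"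
  shows "words.range_proj w \<in> prod_sums L (leavitt_grading R E n) (leavitt_grading R E (- n))"
proof -
  have "cls (monomial R w) \<otimes>\<^bsub>L\<^esub> cls (monomial R (word_adjoint w)) \<in>
      prod_sums L (leavitt_grading R E n) (leavitt_grading R E (- n))"
    using cls_monomial_in_grading[of w] cls_monomial_in_grading[of "word_adjoint w"] w n
      graded.component_subset
    by (intro L.mult_in_prod_sums) simp_all
  then show ?thesis using w by (simp add: words.range_proj_def word_eq_cls)
qed

lemma common_unit:
  assumes "finite W" "W \<subseteq> lists (lpa_gens E)" "[] \<notin> W" and deg: "\<And>w. w \<in> W \<Longrightarrow> word_degree w = n"
  shows "\<exists>t \<in> prod_sums L (leavitt_grading R E n) (leavitt_grading R E (- n)).
    t \<in> carrier Q \<and>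
    (\<forall>w\<in>W. t \<otimes>\<^bsub>Q\<^esub> words.range_proj w = words.range_proj w \<and> words.range_proj w \<otimes>\<^bsub>Q\<^esub> t = words.range_proj w)"
proof -
  let ?T = "prod_sums L (leavitt_grading R E n) (leavitt_grading R E (- n))"
  interpret T: rng "L\<lparr>carrier := ?T\<rparr>"
    by (rule graded.prod_sums_inverse_components_rng) simp_all
  interpret T_sub: additive_subgroup ?T L
    by (intro L.prod_sums_additive_subgroup leavitt_grading_subgroup)
  have T_sub: "?T \<subseteq> carrier Q" using T_sub.a_subset L_subset_Q by blast
  have T_minus: "\<ominus>\<^bsub>Q\<^esub> a \<in> ?T" if "a \<in> ?T" for a
    using that T_sub.a_inv_closed[OF that] T_sub.a_subset L_a_inv[of a] by (simp only: subset_iff)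
  have "\<exists>t\<in>?T. (\<forall>u\<in>lists (lpa_gens E). t \<otimes>\<^bsub>Q\<^esub> words.range_proj u = words.range_proj u \<otimes>\<^bsub>Q\<^esub> t) \<and>
      (\<forall>w\<in>W. t \<otimes>\<^bsub>Q\<^esub> words.range_proj w = words.range_proj w)"
  proof (rule words.range_proj_common_unit[OF assms(1,2) T_sub])
    show "\<zero>\<^bsub>Q\<^esub> \<in> ?T" using T_sub.zero_closed by simp
    show "a \<oplus>\<^bsub>Q\<^esub> b \<in> ?T" if "a \<in> ?T" "b \<in> ?T" for a b using T_sub.a_closed[OF that] by simp
    show "a \<otimes>\<^bsub>Q\<^esub> b \<in> ?T" if "a \<in> ?T" "b \<in> ?T" for a b using T.rng_m_closed[of a b] that by simp
    show "words.range_proj w \<in> ?T" if "w \<in> W" for w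
      using that assms by (intro range_proj_in_prod_sums) auto
  qed (rule T_minus)
  then obtain t where t: "t \<in> ?T"
    and comm: "\<And>u. u \<in> lists (lpa_gens E) \<Longrightarrow> t \<otimes>\<^bsub>Q\<^esub> words.range_proj u = words.range_proj u \<otimes>\<^bsub>Q\<^esub> t"
    and unit: "\<And>w. w \<in> W \<Longrightarrow> t \<otimes>\<^bsub>Q\<^esub> words.range_proj w = words.range_proj w"
    by blast
  have "words.range_proj w \<otimes>\<^bsub>Q\<^esub> t = words.range_proj w" if "w \<in> W" for w
    using comm[of w] unit[OF that] that assms(2) by (simp only: subset_iff)
  then show ?thesis
    using unit subsetD[OF T_sub t] by (intro bexI[OF _ t] conjI ballI)
qed

text \<open>
  Coefficients commute with words. Both sides are needed: a left unit of the word has to reach the word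
  from the left, a right unit from the right.
\<close>

lemma cls_scaled_word:
  assumes "r \<in> carrier R" "w \<in> lists (lpa_gens E)"
  shows "cls (scaled_word R r w) = cls (scaled_word R r []) \<otimes>\<^bsub>Q\<^esub> words.word w"
    and "cls (scaled_word R r w) = words.word w \<otimes>\<^bsub>Q\<^esub> cls (scaled_word R r [])"
proof -
  have r: "scaled_word R r [] \<in> carrier F" using assms by (intro scaled_word_in_free_algebra) auto
  have eqs: "scaled_word R r w = scaled_word R r [] \<otimes>\<^bsub>F\<^esub> monomial R w"
    "scaled_word R r w = monomial R w \<otimes>\<^bsub>F\<^esub> scaled_word R r []"
    using assms
    by (simp_all add: free_algebra_simps(2) monomial_eq_scaled_word convolution_scaled_word_scaled_word)
  show "cls (scaled_word R r w) = cls (scaled_word R r []) \<otimes>\<^bsub>Q\<^esub> words.word w"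
    using r assms by (subst eqs(1)) (simp add: word_eq_cls monomial_closed)
  show "cls (scaled_word R r w) = words.word w \<otimes>\<^bsub>Q\<^esub> cls (scaled_word R r [])"
    using r assms by (subst eqs(2)) (simp add: word_eq_cls monomial_closed)
qed

lemma support_of_homogeneous:
  assumes "p \<in> homogeneous_polys n"
  shows "finite {w. p w \<noteq> \<zero>}" "{w. p w \<noteq> \<zero>} \<subseteq> lists (lpa_gens E)" "[] \<notin> {w. p w \<noteq> \<zero>}"
    "\<And>w. w \<in> {w. p w \<noteq> \<zero>} \<Longrightarrow> word_degree w = n"
  using assms by (auto simp: homogeneous_polys_def free_nonunital_iff free_algebra_simps(1) homogeneous_def)

lemma left_unit:
  assumes "x \<in> leavitt_grading R E n"
  shows "\<exists>t \<in> prod_sums L (leavitt_grading R E n) (leavitt_grading R E (- n)). t \<otimes>\<^bsub>L\<^esub> x = x"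
proof -
  obtain p where p: "p \<in> homogeneous_polys n" and x: "x = cls p"
    using assms unfolding leavitt_grading_eq by blast
  have pF: "p \<in> carrier F" using p by (simp add: homogeneous_polys_def free_nonunital_carrier)
  note supp = support_of_homogeneous[OF p]
  obtain t where t: "t \<in> prod_sums L (leavitt_grading R E n) (leavitt_grading R E (- n))"
    and tQ [simp]: "t \<in> carrier Q"
    and unit: "\<And>w. p w \<noteq> \<zero> \<Longrightarrow> t \<otimes>\<^bsub>Q\<^esub> words.range_proj w = words.range_proj w"
    using common_unit[OF supp] by blast
  have "p \<in> {q \<in> carrier F. t \<otimes>\<^bsub>Q\<^esub> cls q = cls q}"
  proof (rule free_algebra_sum_of_scaled_words[OF pF])
    fix w assume w: "p w \<noteq> \<zero>"
    have wl: "w \<in> lists (lpa_gens E)" using supp(2) w by blast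
    have r: "p w \<in> carrier R" using pF by (simp add: free_algebra_simps(1))
    have sr: "cls (scaled_word R (p w) []) \<in> carrier Q"
      using r by (intro quot.hom_closed scaled_word_in_free_algebra) auto
    have "t \<otimes>\<^bsub>Q\<^esub> words.word w = (t \<otimes>\<^bsub>Q\<^esub> words.range_proj w) \<otimes>\<^bsub>Q\<^esub> words.word w"
      using wl by (simp add: Q.m_assoc words.range_proj_word)
    then have "t \<otimes>\<^bsub>Q\<^esub> words.word w = words.word w"
      using wl w by (simp add: unit words.range_proj_word)
    then have "t \<otimes>\<^bsub>Q\<^esub> cls (scaled_word R (p w) w) = cls (scaled_word R (p w) w)"
      using wl r sr by (simp add: cls_scaled_word(2)[OF r wl] Q.m_assoc[symmetric])
    then show "scaled_word R (p w) w \<in> {q \<in> carrier F. t \<otimes>\<^bsub>Q\<^esub> cls q = cls q}"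
      using r wl by (simp add: scaled_word_in_free_algebra)
  qed (auto simp: Q.r_distr)
  then show ?thesis using t x by auto
qed

text \<open>
  The idempotent \<open>w\<^sup>* w\<close> belongs to the word \<open>w\<^sup>*\<close> of degree \<open>- n\<close>, so the common unit of
  the adjoint words is used.
\<close>

lemma right_unit:
  assumes "x \<in> leavitt_grading R E n"
  shows "\<exists>t \<in> prod_sums L (leavitt_grading R E (- n)) (leavitt_grading R E n). x \<otimes>\<^bsub>L\<^esub> t = x"
proof -
  obtain p where p: "p \<in> homogeneous_polys n" and x: "x = cls p"
    using assms unfolding leavitt_grading_eq by blast
  have pF: "p \<in> carrier F" using p by (simp add: homogeneous_polys_def free_nonunital_carrier)
  note supp = support_of_homogeneous[OF p]
  let ?W = "word_adjoint ` {w. p w \<noteq> \<zero>}"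
  have "\<exists>t \<in> prod_sums L (leavitt_grading R E (- n)) (leavitt_grading R E (- (- n))).
    t \<in> carrier Q \<and>
    (\<forall>w\<in>?W. t \<otimes>\<^bsub>Q\<^esub> words.range_proj w = words.range_proj w \<and> words.range_proj w \<otimes>\<^bsub>Q\<^esub> t = words.range_proj w)"
  proof (rule common_unit)
    show "finite ?W" using supp(1) by simp
    show "?W \<subseteq> lists (lpa_gens E)"
      using supp(2) word_adjoint_lists by blast
    show "[] \<notin> ?W"
      using supp(3) word_adjoint_eq_Nil by (metis imageE)
    show "word_degree w = - n" if "w \<in> ?W" for w
      using that supp(4) word_degree_adjoint by (metis imageE)
  qed
  then obtain t where t: "t \<in> prod_sums L (leavitt_grading R E (- n)) (leavitt_grading R E n)"
    and tQ [simp]: "t \<in> carrier Q"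
    and unit: "\<And>w. p w \<noteq> \<zero> \<Longrightarrow>
      words.range_proj (word_adjoint w) \<otimes>\<^bsub>Q\<^esub> t = words.range_proj (word_adjoint w)"
    by auto
  have "p \<in> {q \<in> carrier F. cls q \<otimes>\<^bsub>Q\<^esub> t = cls q}"
  proof (rule free_algebra_sum_of_scaled_words[OF pF])
    fix w assume w: "p w \<noteq> \<zero>"
    have wl: "w \<in> lists (lpa_gens E)" using supp(2) w by blast
    have r: "p w \<in> carrier R" using pF by (simp add: free_algebra_simps(1))
    have sr: "cls (scaled_word R (p w) []) \<in> carrier Q"
      using r by (intro quot.hom_closed scaled_word_in_free_algebra) auto
    have "words.word w \<otimes>\<^bsub>Q\<^esub> t = words.word w \<otimes>\<^bsub>Q\<^esub> words.range_proj (word_adjoint w) \<otimes>\<^bsub>Q\<^esub> t"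
      using wl by (simp add: words.word_range_proj_adjoint)
    also have "\<dots> = words.word w \<otimes>\<^bsub>Q\<^esub> (words.range_proj (word_adjoint w) \<otimes>\<^bsub>Q\<^esub> t)"
      using wl by (intro Q.m_assoc) simp_all
    also have "\<dots> = words.word w"
      by (simp only: unit[OF w] words.word_range_proj_adjoint[OF wl])
    finally have "cls (scaled_word R (p w) w) \<otimes>\<^bsub>Q\<^esub> t = cls (scaled_word R (p w) w)"
      using wl r sr by (simp add: cls_scaled_word(1)[OF r wl] Q.m_assoc)
    then show "scaled_word R (p w) w \<in> {q \<in> carrier F. cls q \<otimes>\<^bsub>Q\<^esub> t = cls q}"
      using r wl by (simp add: scaled_word_in_free_algebra)
  qed (auto simp: Q.l_distr)
  then show ?thesis using t x by auto
qed

end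

theorem theorem3:
  fixes E :: "('v, 'e) pre_digraph" and R :: "('r, 'm) ring_scheme"
  assumes "wf_digraph E" and "ring R"
  shows "nearly_epsilon_strongly_graded integer_group
    (leavitt_path_algebra R E) (leavitt_grading R E)"
proof -
  interpret leavitt R E by (intro leavitt.intro assms)
  show ?thesis
    by (rule graded.nearly_epsilon_strongly_gradedI) (simp_all add: left_unit right_unit del: L_simps)
qed

end
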